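(* Let $D$ be an inner-strict cylindric diagram and $k\ge1$ an integer. If $D$ can be tiled with $k$-ribbons, then the parity of the total height of the ribbons is independent of the tiling, i.e. any two $k$-ribbon tilings of $D$ have total heights of the same parity.
   Context: Fix integers $x,y\ge 1$. $\mathfrak{C}_{x,y}$ is the lattice $\mathbb{Z}^2$ modulo translation by $(x,-y)$; boxes of $\mathfrak{C}_{x,y}$ are unit boxes of the plane modulo this translation. A boundary loop is the image in $\mathfrak{C}_{x,y}$ of an infinite lattice path with unit steps right (encoded by the letter $0$) and down (encoded by the letter $1$) that is invariant under translation by $(x,-y)$; one period is a cyclic binary word with $x$ zeros and $y$ ones. A cylindric diagram $D$ on $\mathfrak{C}_{x,y}$ is a pair of boundary loops $(B_I,B_O)$ (inner and outer boundary) with $B_I$ weakly left/below $B_O$; it is identified with the finite set of boxes between them. It is empty if $B_I=B_O$. $D$ is inner-strict if its inner boundary is a staircase, i.e. the cyclic word of $B_I$ is $101010\cdots10$ (in particular $x=y$). A $k$-ribbon ($k\le x+y$) is a cylindric diagram with exactly $k$ boxes that is connected (via edge-adjacent boxes) and contains no $2\times2$ block. Its height is the number of pairs of vertically adjacent boxes in it (equivalently, for a ribbon with fewer than $x+y$ boxes, the number of rows it meets, when unrolled in the plane, minus one; for a loop ribbon, i.e. one with $x+y$ boxes, the height is $y$). A $k$-ribbon tiling of $D=(B_I,B_O)$ is a sequence of cylindric diagrams $\emptyset=D_0\subset D_1\subset\dots\subset D_s=D$, all with inner boundary $B_I$, such that each $D_i/D_{i-1}$ (the diagram between the outer boundaries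 of $D_{i-1}$ and $D_i$) is a $k$-ribbon. Its total height is the sum of the heights of the ribbons $D_i/D_{i-1}$. *)

theory Defs
  imports "HOL-Library.Product_Plus"
begin

text \<open>
  Lattice points are integer pairs, with the second coordinate pointing upwards; a unit box is
  named by its lower left corner. Hence points and boxes of the cylinder are both classes of
  integer pairs modulo translation by \<open>(x, -y)\<close>.
\<close>

definition cyl_rel :: "nat \<Rightarrow> nat \<Rightarrow> ((int \<times> int) \<times> (int \<times> int)) set" where
  "cyl_rel x y = {((a, b), (a', b')). \<exists>m::int. a' = a + m * int x \<and> b' = b - m * int y}"

definition cyl_class :: "nat \<Rightarrow> nat \<Rightarrow> int \<times> int \<Rightarrow> (int \<times> int) set" where
  "cyl_class x y v = cyl_rel x y `` {v}"

text \<open>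
  Along a path with unit steps right and down, the difference of the coordinates increases by one
  at each step. So invariance under translation by \<open>(x, -y)\<close> means that \<open>x + y\<close> further steps
  displace every vertex by exactly \<open>(x, -y)\<close>.
\<close>

definition periodic_path :: "nat \<Rightarrow> nat \<Rightarrow> (int \<Rightarrow> int \<times> int) \<Rightarrow> bool" where
  "periodic_path x y p \<longleftrightarrow>
     (\<forall>t. p (t + 1) = p t + (1, 0) \<or> p (t + 1) = p t + (0, -1)) \<and>
     (\<forall>t. p (t + int (x + y)) = p t + (int x, - int y))"

definition path_letter :: "(int \<Rightarrow> int \<times> int) \<Rightarrow> int \<Rightarrow> nat" where
  "path_letter p t = (if p (t + 1) = p t + (1, 0) then 0 else 1)"

definition loop_of_path :: "nat \<Rightarrow> nat \<Rightarrow> (int \<Rightarrow> int \<times> int) \<Rightarrow> (int \<times> int) set set" where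
  "loop_of_path x y p = cyl_class x y ` range p"

definition boundary_loop :: "nat \<Rightarrow> nat \<Rightarrow> (int \<times> int) set set \<Rightarrow> bool" where
  "boundary_loop x y B \<longleftrightarrow> (\<exists>p. periodic_path x y p \<and> B = loop_of_path x y p)"

text \<open>
  The word of a loop is defined up to rotation only: it depends on the vertex from which the
  period is read.
\<close>

definition loop_has_word :: "nat \<Rightarrow> nat \<Rightarrow> (int \<times> int) set set \<Rightarrow> nat list \<Rightarrow> bool" where
  "loop_has_word x y B w \<longleftrightarrow>
     (\<exists>p. periodic_path x y p \<and> B = loop_of_path x y p \<and>
          w = map (\<lambda>i. path_letter p (int i)) [0..<x + y])"

text \<open>
  Every vertex of the second loop (unrolled in the plane) lies weakly above and to the right of
  some vertex of the first one.
\<close>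

definition weakly_left_below :: "(int \<times> int) set set \<Rightarrow> (int \<times> int) set set \<Rightarrow> bool" where
  "weakly_left_below B B' \<longleftrightarrow>
     (\<forall>(a', b') \<in> \<Union>B'. \<exists>(a, b) \<in> \<Union>B. a \<le> a' \<and> b \<le> b')"

text \<open>
  The boxes on the upper right side of a loop: since the loop runs right and down, these are the
  boxes whose lower left corner dominates a vertex of the loop.
\<close>

definition upper_right_boxes ::
  "nat \<Rightarrow> nat \<Rightarrow> (int \<times> int) set set \<Rightarrow> (int \<times> int) set set" where
  "upper_right_boxes x y B =
     {cyl_class x y (a', b') | a' b'. \<exists>(a, b) \<in> \<Union>B. a \<le> a' \<and> b \<le> b'}"

type_synonym diagram = "(int \<times> int) set set \<times> (int \<times> int) set set"

definition cylindric_diagram :: "nat \<Rightarrow> nat \<Rightarrow> diagram \<Rightarrow> bool" where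
  "cylindric_diagram x y D \<longleftrightarrow>
     boundary_loop x y (fst D) \<and> boundary_loop x y (snd D) \<and> weakly_left_below (fst D) (snd D)"

definition boxes :: "nat \<Rightarrow> nat \<Rightarrow> diagram \<Rightarrow> (int \<times> int) set set" where
  "boxes x y D = upper_right_boxes x y (fst D) - upper_right_boxes x y (snd D)"

text \<open>The word \<open>10...10\<close> below has length \<open>2 * x\<close>, so this forces \<open>x = y\<close>.\<close>

definition inner_strict :: "nat \<Rightarrow> nat \<Rightarrow> diagram \<Rightarrow> bool" where
  "inner_strict x y D \<longleftrightarrow> loop_has_word x y (fst D) (concat (replicate x [1, 0]))"

definition right_of :: "(int \<times> int) set \<Rightarrow> (int \<times> int) set \<Rightarrow> bool" where
  "right_of d c \<longleftrightarrow> (\<exists>(a, b) \<in> c. (a + 1, b) \<in> d)"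

definition above :: "(int \<times> int) set \<Rightarrow> (int \<times> int) set \<Rightarrow> bool" where
  "above d c \<longleftrightarrow> (\<exists>(a, b) \<in> c. (a, b + 1) \<in> d)"

definition edge_adjacent :: "(int \<times> int) set \<Rightarrow> (int \<times> int) set \<Rightarrow> bool" where
  "edge_adjacent c d \<longleftrightarrow> right_of d c \<or> right_of c d \<or> above d c \<or> above c d"

definition edge_connected :: "(int \<times> int) set set \<Rightarrow> bool" where
  "edge_connected S \<longleftrightarrow>
     (\<forall>c \<in> S. \<forall>d \<in> S. (c, d) \<in> {(u, v). u \<in> S \<and> v \<in> S \<and> edge_adjacent u v}\<^sup>*)"

definition has_block :: "nat \<Rightarrow> nat \<Rightarrow> (int \<times> int) set set \<Rightarrow> bool" where
  "has_block x y S \<longleftrightarrow>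
     (\<exists>a b. cyl_class x y (a, b) \<in> S \<and> cyl_class x y (a + 1, b) \<in> S \<and>
            cyl_class x y (a, b + 1) \<in> S \<and> cyl_class x y (a + 1, b + 1) \<in> S)"

definition ribbon :: "nat \<Rightarrow> nat \<Rightarrow> nat \<Rightarrow> diagram \<Rightarrow> bool" where
  "ribbon x y k D \<longleftrightarrow>
     k \<le> x + y \<and> cylindric_diagram x y D \<and> card (boxes x y D) = k \<and>
     edge_connected (boxes x y D) \<and> \<not> has_block x y (boxes x y D)"

text \<open>
  Each pair of vertically adjacent boxes is counted once: two boxes cannot lie above each other
  in both directions, since \<open>(0, 2)\<close> is not a multiple of \<open>(x, -y)\<close> for positive \<open>x\<close>.
\<close>

definition height :: "nat \<Rightarrow> nat \<Rightarrow> diagram \<Rightarrow> nat" where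
  "height x y D = card {(c, d). c \<in> boxes x y D \<and> d \<in> boxes x y D \<and> above d c}"

definition diagram_quotient :: "diagram \<Rightarrow> diagram \<Rightarrow> diagram" where
  "diagram_quotient E D = (snd D, snd E)"

text \<open>A tiling with \<open>s\<close> ribbons is the list of the \<open>s + 1\<close> diagrams \<open>D\<^sub>0, ..., D\<^sub>s\<close>.\<close>

definition ribbon_tiling :: "nat \<Rightarrow> nat \<Rightarrow> nat \<Rightarrow> diagram \<Rightarrow> diagram list \<Rightarrow> bool" where
  "ribbon_tiling x y k D T \<longleftrightarrow>
     T \<noteq> [] \<and> hd T = (fst D, fst D) \<and> last T = D \<and>
     (\<forall>E \<in> set T. cylindric_diagram x y E \<and> fst E = fst D) \<and>
     (\<forall>i. Suc i < length T \<longrightarrow>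
        boxes x y (T ! i) \<subset> boxes x y (T ! Suc i) \<and>
        ribbon x y k (diagram_quotient (T ! Suc i) (T ! i)))"

definition total_height :: "nat \<Rightarrow> nat \<Rightarrow> diagram list \<Rightarrow> nat" where
  "total_height x y T =
     (\<Sum>i < length T - 1. height x y (diagram_quotient (T ! Suc i) (T ! i)))"

end

theory Submission
  imports Defs
begin

text \<open>
  The proof turns a tiling into a game with beads on a line and compares two plays by the parity of a
  permutation. Put \<open>n = x + y\<close>. A boundary loop has one vertex of each content \<open>a - b\<close>; placing a bead at
  every content where the loop steps down gives an \<open>n\<close>-periodic set of integers. Adding a \<open>k\<close>-ribbon
  with \<open>k < n\<close> lets one bead, together with its translates by multiples of \<open>n\<close>, jump \<open>k\<close> places to the
  right into a gap, and the height of the ribbon is the number of beads that are jumped over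
  (\<open>ribbon_bead_move\<close>). For \<open>k = n\<close> every ribbon is a loop of height \<open>y\<close>, and the number of ribbons is
  fixed by the area, so only the case \<open>k < n\<close> is of interest.

  Label the beads by integers such that label \<open>j + x\<close> belongs to the translate by \<open>n\<close> of bead \<open>j\<close>, and let
  the labels travel with the beads. For such a labelling \<open>f\<close>, the sum over all pairs of labels modulo \<open>x\<close>
  of \<open>(f v - f u) div n\<close>, suitably normalised, changes by the height modulo 2 in each
  jump (\<open>bead_move\<close>). Hence the total height has the parity of the difference between the values for the
  final and the initial labelling. It remains to see that the value of the final labelling modulo 2
  does not depend on the tiling, although the labelling itself may: on a cylinder the beads of one
  residue class may advance while those of another class stay behind.

  Beads congruent modulo \<open>k\<close> never overtake each other. Starting from the staircase, where bead \<open>j\<close> stands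
  at \<open>2 * j + e\<close>, this forces two final labellings to differ by a relabelling
  \<open>s j = j + K * c j\<close>, where \<open>c\<close> has the periods \<open>K\<close> and \<open>x\<close> and \<open>K\<close> is \<open>k\<close> or half of it
  (\<open>crossings_parity_unique\<close>). Both tilings have the same number of ribbons, so \<open>c\<close> has sum zero over a
  period. The crossing parity is additive under relabelling (\<open>crossings_comp\<close>), and translation by 1,
  which has no crossings, permutes the classes of labels transitively. So pushing a class by one step
  has the same parity for all classes, and the pushes in \<open>s\<close> cancel (\<open>crossings_runner_shift\<close>).
\<close>

section \<open>Crossings of labelled beads\<close>

definition quasi_periodic :: "int \<Rightarrow> int \<Rightarrow> (int \<Rightarrow> int) \<Rightarrow> bool" where
  "quasi_periodic x n f \<longleftrightarrow> (\<forall>j. f (j + x) = f j + n)"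

text \<open>
  Let \<open>f\<close> give the position of bead \<open>j\<close> on the line, where bead \<open>j + x\<close> is the translate by \<open>n\<close> of
  bead \<open>j\<close>. The quotient \<open>(f v - f u) div n\<close> changes by one each time a translate of bead \<open>u\<close>
  overtakes bead \<open>v\<close>. Subtracting the quotient of the indices and reducing modulo 2 makes the value
  symmetric in \<open>u\<close> and \<open>v\<close> and dependent on their residues modulo \<open>x\<close> only, so that it can be
  summed over the unordered pairs of residues. The total is the analogue, for periodic labellings,
  of the parity of the inversion number of a permutation.
\<close>

definition crossing :: "int \<Rightarrow> int \<Rightarrow> (int \<Rightarrow> int) \<Rightarrow> int \<Rightarrow> int \<Rightarrow> int" where
  "crossing x n f u v = ((f v - f u) div n - (v - u) div x) mod 2"

definition crossings :: "int \<Rightarrow> int \<Rightarrow> (int \<Rightarrow> int) \<Rightarrow> int" where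
  "crossings x n f = (\<Sum>v\<in>{0..<x}. \<Sum>u\<in>{0..<v}. crossing x n f u v)"

lemma quasi_periodic_mult:
  assumes "quasi_periodic x n f"
  shows "f (j + m * x) = f j + m * n"
proof (induction m rule: int_induct[where k=0])
  case base
  show ?case by simp
next
  case (step1 i)
  have "f ((j + i * x) + x) = f (j + i * x) + n"
    using assms by (simp only: quasi_periodic_def)
  moreover have "(j + i * x) + x = j + (i + 1) * x" by (simp add: algebra_simps)
  ultimately have "f (j + (i + 1) * x) = f (j + i * x) + n" by metis
  then show ?case using step1 by (simp add: algebra_simps)
next
  case (step2 i)
  have "f ((j + (i - 1) * x) + x) = f (j + (i - 1) * x) + n"
    using assms by (simp only: quasi_periodic_def)
  moreover have "(j + (i - 1) * x) + x = j + i * x" by (simp add: algebra_simps)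
  ultimately have "f (j + i * x) = f (j + (i - 1) * x) + n" by metis
  then show ?case using step2 by (simp add: algebra_simps)
qed

lemma quasi_periodic_mod:
  assumes "quasi_periodic x n f"
  shows "f (j mod x) = f j - (j div x) * n"
proof -
  have "f (j mod x + (j div x) * x) = f (j mod x) + (j div x) * n"
    using quasi_periodic_mult[OF assms] .
  then show ?thesis by simp
qed

lemma quasi_periodic_cong_imp_cong:
  assumes "quasi_periodic x n f" and "inj f" and "n dvd f v - f u"
  shows "x dvd v - u"
proof -
  obtain m where "f v - f u = n * m" using assms(3) by auto
  then have "f v = f (u + m * x)"
    using quasi_periodic_mult[OF assms(1), of u m] by (simp add: algebra_simps)
  then have "v = u + m * x" using assms(2) by (auto dest: injD)
  then show ?thesis by simp
qed

text \<open>
  Exchanging \<open>u\<close> and \<open>v\<close> replaces each of the two quotients \<open>q\<close> by \<open>- q - 1\<close>, as neither division is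
  exact; the two changes cancel modulo 2.
\<close>

lemma crossing_commute:
  assumes f: "quasi_periodic x n f" "inj f" and "x > 0" "n > 0" and uv: "\<not> x dvd v - u"
  shows "crossing x n f v u = crossing x n f u v"
proof -
  have flip: "(- a) div m = - (a div m) - 1" if "\<not> m dvd a" "m > 0" for a m :: int
    using that zdiv_zminus1_eq_if[of m a] by (auto simp: dvd_eq_mod_eq_0)
  have 1: "(f u - f v) div n = - ((f v - f u) div n) - 1"
    using flip[of n "f v - f u"] quasi_periodic_cong_imp_cong[OF f] uv \<open>n > 0\<close>
    by (metis minus_diff_eq)
  have 2: "(u - v) div x = - ((v - u) div x) - 1"
    using flip[of x "v - u"] uv \<open>x > 0\<close> by auto
  have "even (((f u - f v) div n - (u - v) div x) - ((f v - f u) div n - (v - u) div x))"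
    unfolding 1 2 by simp
  then show ?thesis unfolding crossing_def by (simp add: mod_eq_dvd_iff)
qed

lemma crossing_mod:
  assumes f: "quasi_periodic x n f" and "x > 0" "n > 0"
  shows "crossing x n f (u mod x) (v mod x) = crossing x n f u v"
proof -
  have "(f (v mod x) - f (u mod x)) div n = (f v - f u) div n - v div x + u div x"
  proof -
    have "f (v mod x) - f (u mod x) = (f v - f u) + (u div x - v div x) * n"
      by (simp add: quasi_periodic_mod[OF f] algebra_simps)
    then show ?thesis using \<open>n > 0\<close> by simp
  qed
  moreover have "(v mod x - u mod x) div x = (v - u) div x - v div x + u div x"
  proof -
    have "v mod x - u mod x = (v - u) + (u div x - v div x) * x"
      by (simp add: algebra_simps minus_div_mult_eq_mod[symmetric])
    then show ?thesis using \<open>x > 0\<close> by simp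
  qed
  ultimately show ?thesis unfolding crossing_def by simp
qed

lemma sum_ordered_pairs:
  fixes h :: "int \<Rightarrow> int \<Rightarrow> int"
  assumes sym: "\<And>u v. \<lbrakk>u \<in> {0..<x}; v \<in> {0..<x}; u \<noteq> v\<rbrakk> \<Longrightarrow> h v u = h u v"
  shows "(\<Sum>v\<in>{0..<x}. \<Sum>u\<in>{0..<x} - {v}. h u v) = 2 * (\<Sum>v\<in>{0..<x}. \<Sum>u\<in>{0..<v}. h u v)"
proof -
  have "(\<Sum>u\<in>{0..<x} - {v}. h u v) = (\<Sum>u\<in>{0..<v}. h u v) + (\<Sum>u\<in>{v<..<x}. h v u)"
    if "v \<in> {0..<x}" for v
  proof -
    have split: "{0..<x} - {v} = {0..<v} \<union> {v<..<x}" using that by auto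
    have "(\<Sum>u\<in>{0..<x} - {v}. h u v) = (\<Sum>u\<in>{0..<v}. h u v) + (\<Sum>u\<in>{v<..<x}. h u v)"
      unfolding split by (rule sum.union_disjoint) auto
    moreover have "(\<Sum>u\<in>{v<..<x}. h u v) = (\<Sum>u\<in>{v<..<x}. h v u)"
      by (rule sum.cong[OF refl], rule sym) (use that in auto)
    ultimately show ?thesis by simp
  qed
  then have "(\<Sum>v\<in>{0..<x}. \<Sum>u\<in>{0..<x} - {v}. h u v)
      = (\<Sum>v\<in>{0..<x}. \<Sum>u\<in>{0..<v}. h u v) + (\<Sum>v\<in>{0..<x}. \<Sum>u\<in>{v<..<x}. h v u)"
    by (simp add: sum.distrib)
  moreover have "(\<Sum>v\<in>{0..<x}. \<Sum>u\<in>{v<..<x}. h v u) = (\<Sum>u\<in>{0..<x}. \<Sum>v\<in>{0..<u}. h v u)"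
  proof -
    have "(\<Sum>v\<in>{0..<x}. \<Sum>u\<in>{v<..<x}. h v u) = (\<Sum>(v,u)\<in>Sigma {0..<x} (\<lambda>v. {v<..<x}). h v u)"
      by (rule sum.Sigma) auto
    also have "\<dots> = (\<Sum>(u,v)\<in>Sigma {0..<x} (\<lambda>u. {0..<u}). h v u)"
      by (rule sum.reindex_bij_witness[of _ "\<lambda>(a,b). (b,a)" "\<lambda>(a,b). (b,a)"]) auto
    also have "\<dots> = (\<Sum>u\<in>{0..<x}. \<Sum>v\<in>{0..<u}. h v u)"
      by (rule sum.Sigma[symmetric]) auto
    finally show ?thesis .
  qed
  ultimately show ?thesis by simp
qed

lemma bij_betw_mod:
  assumes s: "quasi_periodic x x s" "inj s" and "x > 0"
  shows "bij_betw (\<lambda>j. s j mod x) {0..<x} {0..<x}"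
proof -
  have "inj_on (\<lambda>j. s j mod x) {0..<x}"
  proof (rule inj_onI)
    fix u v assume uv: "u \<in> {0..<x}" "v \<in> {0..<x}" "s u mod x = s v mod x"
    then have "x dvd s v - s u" by (metis mod_eq_dvd_iff)
    then have "x dvd v - u" using quasi_periodic_cong_imp_cong[OF s] by blast
    then have "v mod x = u mod x" by (simp add: mod_eq_dvd_iff)
    then show "u = v" using uv by simp
  qed
  moreover have "(\<lambda>j. s j mod x) ` {0..<x} \<subseteq> {0..<x}" using \<open>x > 0\<close> by auto
  ultimately show ?thesis
    by (simp add: bij_betw_def endo_inj_surj)
qed

text \<open>
  A bijective relabelling permutes the residues modulo \<open>x\<close>, hence their unordered pairs. Passing to
  ordered pairs, where every pair is counted twice, avoids keeping track of the order of the
  two representatives.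
\<close>

lemma sum_pairs_reindex:
  fixes h :: "int \<Rightarrow> int \<Rightarrow> int"
  assumes sym: "\<And>u v. \<not> x dvd v - u \<Longrightarrow> h v u = h u v"
    and per: "\<And>u v. h (u mod x) (v mod x) = h u v"
    and s: "quasi_periodic x x s" "inj s" and "x > 0"
  shows "(\<Sum>v\<in>{0..<x}. \<Sum>u\<in>{0..<v}. h (s u) (s v)) = (\<Sum>v\<in>{0..<x}. \<Sum>u\<in>{0..<v}. h u v)"
proof -
  define p where "p j = s j mod x" for j
  have bij: "bij_betw p {0..<x} {0..<x}"
    unfolding p_def using bij_betw_mod[OF s \<open>x > 0\<close>] .
  have nd: "\<not> x dvd v - u" if "u \<in> {0..<x}" "v \<in> {0..<x}" "u \<noteq> v" for u v
  proof
    assume "x dvd v - u"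
    then have "v mod x = u mod x" by (simp add: mod_eq_dvd_iff)
    then show False using that by simp
  qed
  have "2 * (\<Sum>v\<in>{0..<x}. \<Sum>u\<in>{0..<v}. h (s u) (s v))
      = (\<Sum>v\<in>{0..<x}. \<Sum>u\<in>{0..<x} - {v}. h (s u) (s v))"
    by (rule sum_ordered_pairs[symmetric], rule sym)
       (use nd quasi_periodic_cong_imp_cong[OF s] in blast)
  also have "\<dots> = (\<Sum>v\<in>{0..<x}. \<Sum>u\<in>{0..<x} - {v}. h (p u) (p v))"
    by (simp add: p_def per)
  also have "\<dots> = (\<Sum>v\<in>{0..<x}. \<Sum>u\<in>{0..<x} - {p v}. h u (p v))"
  proof (rule sum.cong[OF refl])
    fix v assume v: "v \<in> {0..<x}"
    have "bij_betw p ({0..<x} - {v}) ({0..<x} - {p v})"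
      using bij v by (auto simp: bij_betw_def inj_on_def)
    then show "(\<Sum>u\<in>{0..<x} - {v}. h (p u) (p v)) = (\<Sum>u\<in>{0..<x} - {p v}. h u (p v))"
      by (rule sum.reindex_bij_betw)
  qed
  also have "\<dots> = (\<Sum>v\<in>{0..<x}. \<Sum>u\<in>{0..<x} - {v}. h u v)"
    using sum.reindex_bij_betw[OF bij, of "\<lambda>v. \<Sum>u\<in>{0..<x} - {v}. h u v"] .
  also have "\<dots> = 2 * (\<Sum>v\<in>{0..<x}. \<Sum>u\<in>{0..<v}. h u v)"
    by (rule sum_ordered_pairs, rule sym) (use nd in blast)
  finally show ?thesis by simp
qed

text \<open>
  The cocycle property that replaces multiplicativity of the sign: for each pair, the quotients
  of \<open>f \<circ> s\<close> at \<open>u, v\<close> split at \<open>(s v - s u) div x\<close> into a crossing of \<open>f\<close> at the pair \<open>s u, s v\<close> and a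
  crossing of \<open>s\<close> at \<open>u, v\<close>.
\<close>

lemma crossings_comp:
  assumes f: "quasi_periodic x n f" "inj f" and s: "quasi_periodic x x s" "inj s"
    and "x > 0" "n > 0"
  shows "even (crossings x n (f \<circ> s) - (crossings x n f + crossings x x s))"
proof -
  let ?S = "\<lambda>h. \<Sum>v\<in>{0..<x}. \<Sum>u\<in>{0..<v}. (h u v :: int)"
  have 1: "crossings x n f = ?S (\<lambda>u v. crossing x n f (s u) (s v))"
    unfolding crossings_def
    by (rule sum_pairs_reindex[symmetric])
       (use assms in \<open>auto intro: crossing_commute crossing_mod\<close>)
  have "even (crossing x n (f \<circ> s) u v - (crossing x n f (s u) (s v) + crossing x x s u v))" for u v
    unfolding crossing_def by simp blast
  then have "even (?S (\<lambda>u v. crossing x n (f \<circ> s) u v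
                   - (crossing x n f (s u) (s v) + crossing x x s u v)))"
    by (intro dvd_sum) auto
  then show ?thesis
    unfolding 1 unfolding crossings_def by (simp add: sum_subtractf sum.distrib)
qed

lemma crossings_translation:
  assumes "x > 0"
  shows "crossings x x (\<lambda>j. j + m) = 0"
  unfolding crossings_def crossing_def by simp

lemma int_recurrence:
  fixes c :: "int \<Rightarrow> int"
  obtains d where "\<And>j. d (j + 1) = d j + c j"
proof
  fix j :: int
  define d where "d j = (if j \<ge> 0 then \<Sum>i\<in>{0..<j}. c i else - (\<Sum>i\<in>{j..<0}. c i))" for j
  show "d (j + 1) = d j + c j"
  proof (cases "j \<ge> 0")
    case True
    then have "{0..<j + 1} = insert j {0..<j}" by auto
    then show ?thesis using True by (simp add: d_def)
  next
    case False
    then have "{j..<0} = insert j {j + 1..<0}" by auto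
    then show ?thesis using False by (cases "j = -1") (auto simp: d_def)
  qed
qed

lemma sum_telescope_int:
  fixes d :: "int \<Rightarrow> int"
  assumes "x \<ge> 0"
  shows "(\<Sum>j\<in>{0..<x}. d (j + 1) - d j) = d x - d 0"
  using assms
proof (induction x rule: int_ge_induct)
  case base
  show ?case by simp
next
  case (step i)
  then have "{0..<i + 1} = insert i {0..<i}" by auto
  then show ?case using step by simp
qed

lemma const_of_step:
  fixes g :: "int \<Rightarrow> int"
  assumes "\<And>j. g (j + 1) = g j"
  shows "g j = g 0"
proof (induction j rule: int_induct[where k=0])
  case (step2 i)
  then show ?case using assms[of "i - 1"] by simp
qed (auto simp: assms)

text \<open>
  A primitive of \<open>c\<close> is \<open>x\<close>-periodic because \<open>c\<close> sums to zero over a period. As \<open>c\<close> is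
  \<open>K\<close>-periodic as well, the increment of the primitive over \<open>K\<close> is a constant, and this constant
  vanishes because after \<open>x\<close> steps of length \<open>K\<close> an \<open>x\<close>-periodic function is back at its value.
\<close>

lemma periodic_primitive:
  fixes c :: "int \<Rightarrow> int"
  assumes cK: "\<And>j. c (j + K) = c j" and cx: "\<And>j. c (j + x) = c j"
    and sum0: "(\<Sum>j\<in>{0..<x}. c j) = 0" and "x > 0"
  obtains d where "\<And>j. d (j + 1) = d j + c j" "\<And>j. d (j + K) = d j" "\<And>j. d (j + x) = d j"
proof -
  obtain d where d: "\<And>j. d (j + 1) = d j + c j" using int_recurrence[of c] by blast
  have "d x - d 0 = 0"
    using sum_telescope_int[of x d] d sum0 \<open>x > 0\<close> by simp
  moreover have "d (j + x) - d j = d (0 + x) - d 0" for j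
    by (rule const_of_step[of "\<lambda>j. d (j + x) - d j"])
       (use d[of "_ + x"] d cx in \<open>simp add: add.assoc add.commute[of 1]\<close>)
  ultimately have dx: "d (j + x) = d j" for j by (metis add_0 eq_iff_diff_eq_0)
  define C where "C = d K - d 0"
  have "d (j + K) - d j = d (0 + K) - d 0" for j
    by (rule const_of_step[of "\<lambda>j. d (j + K) - d j"])
       (use d[of "_ + K"] d cK in \<open>simp add: add.assoc add.commute[of 1]\<close>)
  note const = this
  have dK: "d (j + K) = d j + C" for j using const[of j] unfolding C_def by simp
  have "quasi_periodic K C d" "quasi_periodic x 0 d" using dK dx by (auto simp: quasi_periodic_def)
  then have "d (0 + x * K) = d 0 + x * C" "d (0 + K * x) = d 0 + K * 0"
    using quasi_periodic_mult by blast+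
  then have "C = 0" using \<open>x > 0\<close> by (simp add: mult.commute)
  then show ?thesis using that[of d] d dx dK by simp
qed

text \<open>
  Call the classes of indices on which \<open>c\<close> is constant by its two periods runners. The permutation in
  question pushes every runner by its own number of steps, the numbers adding up to zero. All
  runners are conjugate under \<open>j \<mapsto> j + 1\<close>, so a push by one step has the same parity for each of
  them and the total is even. The proof packs this into one identity: for a primitive \<open>d\<close> of \<open>c\<close> with
  push \<open>t\<close>, one has \<open>t (j + 1) = t (s j) + 1\<close>, and the translation has no crossings.
\<close>

lemma crossings_runner_shift:
  fixes c :: "int \<Rightarrow> int"
  assumes cK: "\<And>j. c (j + K) = c j" and cx: "\<And>j. c (j + x) = c j"
    and sum0: "(\<Sum>j\<in>{0..<x}. c j) = 0" and "x > 0"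
  shows "even (crossings x x (\<lambda>j. j + K * c j))"
proof -
  obtain d where d: "\<And>j. d (j + 1) = d j + c j" and dK: "\<And>j. d (j + K) = d j"
    and dx: "\<And>j. d (j + x) = d j"
    using periodic_primitive[of c K x] assms by blast
  have K_mult: "e (j + K * m) = e j" if "\<And>j. e (j + K) = e j" for e :: "int \<Rightarrow> int" and j m
    using quasi_periodic_mult[of K 0 e j m] that by (simp add: quasi_periodic_def mult.commute)
  have shift_ok: "quasi_periodic x x (\<lambda>j. j + K * e j)" "inj (\<lambda>j. j + K * e j)"
    if eK: "\<And>j. e (j + K) = e j" and ex: "\<And>j. e (j + x) = e j" for e :: "int \<Rightarrow> int"
  proof -
    show "quasi_periodic x x (\<lambda>j. j + K * e j)" using ex by (simp add: quasi_periodic_def)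
    show "inj (\<lambda>j. j + K * e j)"
    proof (rule injI)
      fix u v assume eq: "u + K * e u = v + K * e v"
      then have "e u = e v" using K_mult[of e, OF eK] by metis
      then show "u = v" using eq by simp
    qed
  qed
  define s where "s = (\<lambda>j. j + K * c j)"
  define t where "t = (\<lambda>j. j + K * d j)"
  define up where "up = (\<lambda>j::int. j + 1)"
  have qs: "quasi_periodic x x s" "inj s" unfolding s_def using shift_ok[of c] cK cx by auto
  have qt: "quasi_periodic x x t" "inj t" unfolding t_def using shift_ok[of d] dK dx by auto
  have qu: "quasi_periodic x x up" "inj up" by (auto simp: up_def quasi_periodic_def inj_def)
  have comp: "quasi_periodic x x (g \<circ> h)" "inj (g \<circ> h)"
    if "quasi_periodic x x g" "inj g" "quasi_periodic x x h" "inj h" for g h :: "int \<Rightarrow> int"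
    using that by (auto simp: quasi_periodic_def inj_compose)
  have E: "even (crossings x x (g \<circ> h) - (crossings x x g + crossings x x h))"
    if "quasi_periodic x x g" "inj g" "quasi_periodic x x h" "inj h" for g h :: "int \<Rightarrow> int"
    using crossings_comp[OF that \<open>x > 0\<close> \<open>x > 0\<close>] .
  have conj: "t \<circ> up = up \<circ> (t \<circ> s)"
  proof
    fix j
    have "d (j + K * c j) = d j" using K_mult[of d, OF dK] .
    then show "(t \<circ> up) j = (up \<circ> (t \<circ> s)) j"
      by (simp add: t_def up_def s_def d distrib_left)
  qed
  have u0: "crossings x x up = 0" unfolding up_def using crossings_translation[OF \<open>x > 0\<close>] .
  have a: "even (crossings x x (t \<circ> up) - crossings x x t)" using E[OF qt qu] u0 by simp
  have b: "even (crossings x x (up \<circ> (t \<circ> s)) - crossings x x (t \<circ> s))"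
    using E[OF qu comp[OF qt qs]] u0 by simp
  have e: "even (crossings x x (t \<circ> s) - (crossings x x t + crossings x x s))"
    using E[OF qt qs] .
  have "even (crossings x x s)" using a b e unfolding conj by presburger
  then show ?thesis unfolding s_def .
qed

section \<open>Labellings of a periodic set of beads\<close>

definition labelling :: "int \<Rightarrow> int \<Rightarrow> int set \<Rightarrow> (int \<Rightarrow> int) \<Rightarrow> bool" where
  "labelling x n S f \<longleftrightarrow> quasi_periodic x n f \<and> inj f \<and> range f = S"

lemma sum_of_periodic_reindex:
  fixes h :: "int \<Rightarrow> int"
  assumes h: "\<And>j. h (j mod x) = h j" and s: "quasi_periodic x x s" "inj s" and "x > 0"
  shows "(\<Sum>j\<in>{0..<x}. h (s j)) = (\<Sum>j\<in>{0..<x}. h j)"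
  using sum.reindex_bij_betw[OF bij_betw_mod[OF s \<open>x > 0\<close>], of h] by (simp add: h)

text \<open>
  The hypotheses leave little freedom: the relabelling \<open>s\<close> with \<open>g = f \<circ> s\<close> preserves residues
  modulo \<open>K\<close> and is increasing on each class, so it is a translation there. The equality of the sums
  says that the translations cancel out.
\<close>

lemma crossings_parity_unique:
  assumes f: "labelling x n S f" and g: "labelling x n S g"
    and pos: "x > 0" "n > 0" "K > 0"
    and res: "\<And>u v. f u = g v \<Longrightarrow> K dvd u - v"
    and f_mono: "\<And>u v. \<lbrakk>u < v; K dvd v - u\<rbrakk> \<Longrightarrow> f u < f v"
    and g_mono: "\<And>u v. \<lbrakk>u < v; K dvd v - u\<rbrakk> \<Longrightarrow> g u < g v"
    and sums: "(\<Sum>j\<in>{0..<x}. f j) = (\<Sum>j\<in>{0..<x}. g j)"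
  shows "even (crossings x n f - crossings x n g)"
proof -
  have qf: "quasi_periodic x n f" "inj f" and qg: "quasi_periodic x n g" "inj g"
    and ran: "range f = range g"
    using f g by (auto simp: labelling_def)
  have "\<exists>i. f i = g j" for j
  proof -
    have "g j \<in> range f" using ran by simp
    then show ?thesis by auto
  qed
  then obtain s where s: "\<And>j. f (s j) = g j" by metis
  have s_res: "K dvd s j - j" for j using res s by blast
  have s_per: "s (j + x) = s j + x" for j
  proof -
    have "f (s j + x) = f (s (j + x))" using qf(1) qg(1) s by (simp add: quasi_periodic_def)
    then show ?thesis using injD[OF qf(2)] by metis
  qed
  have s_inj: "inj s"
  proof (rule injI)
    fix u v assume "s u = s v"
    then have "g u = g v" using s by metis
    then show "u = v" by (rule injD[OF qg(2)])
  qed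
  have s_surj: "\<exists>u. s u = v" for v
  proof -
    obtain u where "f v = g u" using ran by blast
    then have "f (s u) = f v" using s by simp
    then show ?thesis using injD[OF qf(2)] by blast
  qed
  have s_mono_iff: "s u < s v \<longleftrightarrow> u < v" if "K dvd v - u" for u v
  proof -
    have *: "s u < s v" if uv: "u < v" "K dvd v - u" for u v
    proof (rule ccontr)
      assume "\<not> s u < s v"
      moreover have "s u \<noteq> s v" using injD[OF s_inj, of u v] uv by auto
      ultimately have "s v < s u" by simp
      moreover have "K dvd (s u - u) - (s v - v) - (v - u)"
        by (rule dvd_diff[OF dvd_diff[OF s_res s_res] uv(2)])
      then have "K dvd s u - s v" by simp
      ultimately have "f (s v) < f (s u)" by (rule f_mono)
      then show False using g_mono[OF uv] s by simp
    qed
    have "K dvd u - v" using that by (metis dvd_minus_iff minus_diff_eq)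
    then show ?thesis using *[of u v] *[of v u] that by (cases u v rule: linorder_cases) auto
  qed
  \<comment> \<open>An increasing bijection of a class onto itself sends the successor of \<open>j\<close> to the successor of
      \<open>s j\<close>, since a value in between would have its preimage between \<open>j\<close> and \<open>j + K\<close>.\<close>
  have s_K: "s (j + K) = s j + K" for j
  proof -
    obtain u where u: "s u = s j + K" using s_surj by blast
    have uj: "K dvd u - j"
    proof -
      have "K dvd (s j - j) - (s u - u) + K" by (rule dvd_add[OF dvd_diff[OF s_res s_res] dvd_refl])
      then show ?thesis using u by simp
    qed
    have "j < u" using s_mono_iff[OF uj] u pos by simp
    then have le: "j + K \<le> u" using uj zdvd_imp_le[OF uj] by simp
    show ?thesis
    proof (rule ccontr)
      assume "s (j + K) \<noteq> s j + K"
      then have "j + K < u" using u le by (cases "u = j + K") auto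
      moreover have "K dvd u - (j + K)" using uj
        by (metis diff_diff_add dvd_diff dvd_refl)
      ultimately have "s (j + K) < s j + K" using s_mono_iff u by metis
      moreover have "s j < s (j + K)" using s_mono_iff[of "j + K" j] pos by simp
      moreover have "K dvd s (j + K) - s j"
      proof -
        have "K dvd (s (j + K) - (j + K)) - (s j - j) + K"
          by (rule dvd_add[OF dvd_diff[OF s_res s_res] dvd_refl])
        then show ?thesis by simp
      qed
      ultimately show False using zdvd_imp_le[of K "s (j + K) - s j"] by simp
    qed
  qed
  define c where "c j = (s j - j) div K" for j
  have sc: "s j = j + K * c j" for j using s_res[of j] by (simp add: c_def)
  have qs: "quasi_periodic x x s" using s_per by (simp add: quasi_periodic_def)
  \<comment> \<open>The combination \<open>x * f j - n * j\<close> is periodic, so its sum over a period is not affected by \<open>s\<close>;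
      this turns the equality of the position sums into one of index sums.\<close>
  have "(\<Sum>j\<in>{0..<x}. x * f (s j) - n * s j) = (\<Sum>j\<in>{0..<x}. x * f j - n * j)"
  proof (rule sum_of_periodic_reindex[where h = "\<lambda>j. x * f j - n * j"])
    fix j
    define q where "q = j div x"
    have q: "j mod x = j - q * x" by (simp add: q_def minus_div_mult_eq_mod)
    have "f (j mod x) = f j - q * n" unfolding q_def by (rule quasi_periodic_mod[OF qf(1)])
    then have "x * f (j mod x) - n * (j mod x) = x * (f j - q * n) - n * (j mod x)" by (rule arg_cong)
    also have "\<dots> = x * f j - n * j" unfolding q by (simp add: algebra_simps)
    finally show "x * f (j mod x) - n * (j mod x) = x * f j - n * j" .
  qed (use qs s_inj pos in auto)
  then have "x * (\<Sum>j\<in>{0..<x}. g j) - n * (\<Sum>j\<in>{0..<x}. s j)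
           = x * (\<Sum>j\<in>{0..<x}. f j) - n * (\<Sum>j\<in>{0..<x}. j)"
    by (simp add: s sum_subtractf sum_distrib_left)
  then have "(\<Sum>j\<in>{0..<x}. s j) = (\<Sum>j\<in>{0..<x}. j)" using sums pos by simp
  then have "K * (\<Sum>j\<in>{0..<x}. c j) = 0"
    by (simp add: sc sum.distrib sum_distrib_left)
  then have "even (crossings x x (\<lambda>j. j + K * c j))"
    using pos s_K s_per by (intro crossings_runner_shift) (auto simp: c_def algebra_simps)
  moreover have "(\<lambda>j. j + K * c j) = s" using sc by auto
  moreover have "f \<circ> s = g" using s by auto
  ultimately show ?thesis
    using crossings_comp[OF qf qs s_inj pos(1,2)] by simp
qed

lemma div_diff_of_less:
  fixes a k n :: int
  assumes "0 < k" "k < n" "a mod n \<noteq> k"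
  shows "(a - k) div n = a div n - of_bool (a mod n < k)"
proof -
  define r where "r = a mod n"
  have r: "0 \<le> r" "r < n" using assms by (auto simp: r_def)
  have "a - k = (r - k) + (a div n) * n" by (simp add: r_def minus_div_mult_eq_mod[symmetric])
  then have "(a - k) div n = ((r - k) + (a div n) * n) div n" by (rule arg_cong)
  then have "(a - k) div n = a div n + (r - k) div n" using assms by simp
  moreover have "(r - k) div n = - of_bool (r < k)"
  proof (cases "r < k")
    case True
    then have "(r - k + n) div n = 0" using assms r by (intro div_pos_pos_trivial) auto
    moreover have "(r - k + n) div n = (r - k) div n + 1" using assms by (intro div_add_self2) auto
    ultimately have "(r - k) div n = -1" by simp
    then show ?thesis using True by simp
  next
    case False
    then show ?thesis using assms r by simp
  qed
  ultimately show ?thesis by (simp add: r_def)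
qed

lemma sum_pairs_through_point:
  fixes j0 x :: int
  assumes "j0 \<in> {0..<x}" "W \<subseteq> {0..<x} - {j0}"
  shows "(\<Sum>v\<in>{0..<x}. \<Sum>u\<in>{0..<v}. of_bool (u = j0 \<and> v \<in> W) + of_bool (v = j0 \<and> u \<in> W) :: int)
       = int (card W)"
proof -
  have fin: "finite W" using assms finite_subset by blast
  have 1: "(\<Sum>u\<in>{0..<v}. of_bool (u = j0 \<and> v \<in> W) :: int) = of_bool (v \<in> W \<inter> {j0<..})" for v
  proof (cases "v \<in> W \<inter> {j0<..}")
    case True
    then have "{0..<v} \<inter> {u. u = j0 \<and> v \<in> W} = {j0}" using assms by auto
    then show ?thesis using True assms(1) by (simp add: of_bool_def sum.If_cases)
  next
    case False
    then have "{0..<v} \<inter> {u. u = j0 \<and> v \<in> W} = {}" using assms by auto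
    then show ?thesis using False by (simp add: of_bool_def sum.If_cases)
  qed
  have 2: "(\<Sum>u\<in>{0..<v}. of_bool (v = j0 \<and> u \<in> W) :: int)
      = (if v = j0 then int (card (W \<inter> {..<j0})) else 0)" for v
  proof -
    have "{0..<j0} \<inter> W = W \<inter> {..<j0}" using assms by auto
    then show ?thesis by (auto simp: of_bool_def sum.If_cases)
  qed
  have "{0..<x} \<inter> (W \<inter> {j0<..}) = W \<inter> {j0<..}" using assms by auto
  then have 3: "(\<Sum>v\<in>{0..<x}. of_bool (v \<in> W \<inter> {j0<..}) :: int) = int (card (W \<inter> {j0<..}))"
    by (simp add: of_bool_def sum.If_cases del: Int_iff)
  have "W = (W \<inter> {j0<..}) \<union> (W \<inter> {..<j0})" using assms by force
  then have "card W = card (W \<inter> {j0<..}) + card (W \<inter> {..<j0})"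
    using fin card_Un_disjoint[of "W \<inter> {j0<..}" "W \<inter> {..<j0}"] by force
  then show ?thesis using assms(1) 3 by (simp add: sum.distrib 1 2 del: Int_iff)
qed

text \<open>
  When bead \<open>i\<close> jumps to the free place \<open>i + k\<close>, and its translates with it, the crossings change
  only at the pairs that contain it. Since \<open>k < n\<close>, each other class of beads is overtaken at most
  once, and it is overtaken exactly if it has a representative strictly between \<open>i\<close> and \<open>i + k\<close>.
\<close>

lemma bead_move:
  assumes f: "labelling x n S f" and pos: "x > 0" "0 < k" "k < n"
    and i: "i \<in> S" "i + k \<notin> S"
    and S': "S' = (S - {t. n dvd t - i}) \<union> {t. n dvd t - (i + k)}"
  obtains f' where "labelling x n S' f'" "\<And>j. f' j = f j \<or> f' j = f j + k"
    "(\<Sum>j\<in>{0..<x}. f' j) = (\<Sum>j\<in>{0..<x}. f j) + k"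
    "even (crossings x n f' - crossings x n f - int (card {t \<in> S. i < t \<and> t < i + k}))"
proof -
  have qf: "quasi_periodic x n f" "inj f" and ran: "range f = S"
    using f by (auto simp: labelling_def)
  have n: "n > 0" using pos by simp
  obtain j1 where j1: "f j1 = i" using i ran by auto
  define j0 where "j0 = j1 mod x"
  have j0: "j0 \<in> {0..<x}" using pos by (simp add: j0_def)
  have fj0: "f j0 = i - (j1 div x) * n"
    unfolding j0_def by (simp add: quasi_periodic_mod[OF qf(1)] j1)
  have dvd_iff: "n dvd f v - f u \<longleftrightarrow> x dvd v - u" for u v
  proof
    assume "x dvd v - u"
    then obtain m where "v = u + m * x" by (metis dvdE diff_add_cancel add.commute mult.commute)
    then show "n dvd f v - f u" using quasi_periodic_mult[OF qf(1)] by simp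
  qed (rule quasi_periodic_cong_imp_cong[OF qf])
  have at_j0: "n dvd f j - i \<longleftrightarrow> j mod x = j0" for j
  proof -
    have "n dvd f j - i \<longleftrightarrow> n dvd f j - f j1" using j1 by simp
    also have "\<dots> \<longleftrightarrow> j mod x = j1 mod x" by (simp add: dvd_iff mod_eq_dvd_iff)
    finally show ?thesis by (simp add: j0_def)
  qed
  have S_per: "t + m * n \<in> S" if "t \<in> S" for t m
  proof -
    have "t \<in> range f" using that ran by simp
    then obtain j where "t = f j" by blast
    then have "t + m * n = f (j + m * x)" using quasi_periodic_mult[OF qf(1)] by simp
    then show ?thesis using ran by blast
  qed
  have hole: "\<not> n dvd t - (i + k)" if "t \<in> S" for t
  proof
    assume "n dvd t - (i + k)"
    then obtain m where "t - (i + k) = n * m" by auto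
    then have "i + k = t + (- m) * n" by (simp add: algebra_simps)
    then show False using S_per[OF that, of "- m"] i by simp
  qed
  define f' where "f' j = f j + k * of_bool (j mod x = j0)" for j
  have qf': "quasi_periodic x n f'" using qf(1) by (simp add: quasi_periodic_def f'_def)
  have inj': "inj f'"
  proof (rule injI)
    fix u v assume eq: "f' u = f' v"
    have no: False if "u mod x = j0" "f' u = f' v" "v mod x \<noteq> j0" for u v
    proof -
      have "f v - (i + k) = f u - i" using that by (simp add: f'_def)
      then have "n dvd f v - (i + k)" using at_j0 that by metis
      then show False using hole ran by blast
    qed
    then have "(u mod x = j0) = (v mod x = j0)" using eq by metis
    then have "f u = f v" using eq by (simp add: f'_def)
    then show "u = v" by (rule injD[OF qf(2)])
  qed
  have ran': "range f' = S'"
  proof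
    show "range f' \<subseteq> S'"
    proof
      fix t assume "t \<in> range f'"
      then obtain j where j: "t = f' j" by auto
      show "t \<in> S'"
      proof (cases "j mod x = j0")
        case True
        then have "t - (i + k) = f j - i" using j by (simp add: f'_def)
        then have "n dvd t - (i + k)" using at_j0[of j] True by metis
        then show ?thesis unfolding S' by simp
      next
        case False
        then have "t = f j" using j by (simp add: f'_def)
        then show ?thesis using at_j0[of j] False ran unfolding S' by auto
      qed
    qed
    show "S' \<subseteq> range f'"
    proof
      fix t assume t: "t \<in> S'"
      show "t \<in> range f'"
      proof (cases "n dvd t - (i + k)")
        case True
        then obtain m where "t - (i + k) = n * m" by auto
        then have "t = f (j1 + m * x) + k"
          using quasi_periodic_mult[OF qf(1), of j1 m] j1 by (simp add: algebra_simps)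
        moreover have "(j1 + m * x) mod x = j0" by (simp add: j0_def)
        ultimately have "t = f' (j1 + m * x)" by (simp add: f'_def)
        then show ?thesis by blast
      next
        case False
        then have "t \<in> S" "\<not> n dvd t - i" using t unfolding S' by auto
        then obtain j where "t = f j" "j mod x \<noteq> j0" using ran at_j0 by blast
        then have "t = f' j" by (simp add: f'_def)
        then show ?thesis by blast
      qed
    qed
  qed
  have sum': "(\<Sum>j\<in>{0..<x}. f' j) = (\<Sum>j\<in>{0..<x}. f j) + k"
  proof -
    have "(\<Sum>j\<in>{0..<x}. of_bool (j mod x = j0) :: int) = (\<Sum>j\<in>{0..<x}. if j = j0 then 1 else 0)"
      by (rule sum.cong) auto
    also have "\<dots> = 1" using j0 by simp
    finally have "(\<Sum>j\<in>{0..<x}. of_bool (j mod x = j0) :: int) = 1" .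
    then show ?thesis unfolding f'_def by (simp add: sum.distrib sum_distrib_left[symmetric])
  qed
  \<comment> \<open>the classes of beads that are jumped over\<close>
  define W where "W = {j \<in> {0..<x} - {j0}. (f j - f j0) mod n < k}"
  have mod_j0: "(f j - f j0) mod n = (f j - i) mod n" for j
    unfolding fj0 by (metis diff_diff_eq2 diff_add_eq mod_mult_self1)
  have bij: "bij_betw (\<lambda>j. i + (f j - i) mod n) W {t \<in> S. i < t \<and> t < i + k}"
  proof (rule bij_betw_imageI)
    show "inj_on (\<lambda>j. i + (f j - i) mod n) W"
    proof (rule inj_onI)
      fix u v assume uv: "u \<in> W" "v \<in> W" "i + (f u - i) mod n = i + (f v - i) mod n"
      then have "n dvd f v - f u" by (simp add: mod_eq_dvd_iff dvd_diff_commute)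
      then have "u mod x = v mod x" using dvd_iff by (simp add: mod_eq_dvd_iff dvd_diff_commute)
      then show "u = v" using uv by (simp add: W_def)
    qed
    show "(\<lambda>j. i + (f j - i) mod n) ` W = {t \<in> S. i < t \<and> t < i + k}"
    proof (intro set_eqI iffI)
      fix t assume "t \<in> (\<lambda>j. i + (f j - i) mod n) ` W"
      then obtain j where j: "j \<in> W" and t: "t = i + (f j - i) mod n" by auto
      have "t = f j + (- ((f j - i) div n)) * n"
        unfolding t by (simp add: minus_div_mult_eq_mod[symmetric])
      then have "t \<in> S" using S_per ran by blast
      moreover have "(f j - i) mod n < k" using j mod_j0 by (simp add: W_def)
      moreover have "(f j - i) mod n \<noteq> 0"
        using at_j0[of j] j by (auto simp: W_def dvd_eq_mod_eq_0)
      moreover have "(f j - i) mod n \<ge> 0" using n by simp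
      ultimately show "t \<in> {t \<in> S. i < t \<and> t < i + k}" using t by auto
    next
      fix t assume "t \<in> {t \<in> S. i < t \<and> t < i + k}"
      then have t: "t \<in> S" "i < t" "t < i + k" by auto
      obtain j where j: "t = f j" using t ran by auto
      have fm: "f (j mod x) - i = (t - i) + (- (j div x)) * n"
        by (simp add: quasi_periodic_mod[OF qf(1)] j)
      have tm: "(t - i) mod n = t - i" using t pos by simp
      have m: "(f (j mod x) - i) mod n = t - i" unfolding fm mod_mult_self1 by (rule tm)
      have "j mod x \<noteq> j0"
      proof
        assume "j mod x = j0"
        then have "n dvd t - i" using at_j0 j by simp
        then show False using tm t by auto
      qed
      then have "j mod x \<in> W" using m mod_j0 t pos by (simp add: W_def)
      moreover have "t = i + (f (j mod x) - i) mod n" using m by simp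
      ultimately show "t \<in> (\<lambda>j. i + (f j - i) mod n) ` W" by blast
    qed
  qed
  then have cardW: "card {t \<in> S. i < t \<and> t < i + k} = card W"
    by (simp add: bij_betw_same_card)
  have step: "even (crossing x n f' j0 v - crossing x n f j0 v - of_bool (v \<in> W))"
    if v: "v \<in> {0..<x}" "v \<noteq> j0" for v
  proof -
    have "(f v - f j0) mod n \<noteq> k"
    proof
      assume "(f v - f j0) mod n = k"
      then have "(f v - i) mod n = k mod n" using mod_j0 pos by simp
      then have "n dvd f v - i - k" by (simp add: mod_eq_dvd_iff)
      then show False using hole[of "f v"] ran by (auto simp: algebra_simps)
    qed
    then have "(f v - f j0 - k) div n = (f v - f j0) div n - of_bool (v \<in> W)"
      using div_diff_of_less[of k n "f v - f j0"] pos v by (simp add: W_def)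
    moreover have "f' v - f' j0 = f v - f j0 - k" using v j0 by (simp add: f'_def)
    ultimately have "(f' v - f' j0) div n = (f v - f j0) div n - of_bool (v \<in> W)" by simp
    then show ?thesis unfolding crossing_def by simp blast
  qed
  have pair: "even (crossing x n f' u v - crossing x n f u v
      - (of_bool (u = j0 \<and> v \<in> W) + of_bool (v = j0 \<and> u \<in> W)))"
    if "v \<in> {0..<x}" "u \<in> {0..<v}" for u v
  proof -
    have nd: "\<not> x dvd v - u" using that by (auto dest: zdvd_imp_le)
    consider "u = j0" | "v = j0" | "u \<noteq> j0" "v \<noteq> j0" by blast
    then show ?thesis
    proof cases
      case 1
      then show ?thesis using step[of v] that by simp
    next
      case 2
      then have "crossing x n f' u v = crossing x n f' j0 u" "crossing x n f u v = crossing x n f j0 u"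
        using crossing_commute[OF qf' inj' pos(1) n nd] crossing_commute[OF qf pos(1) n nd] by simp_all
      then show ?thesis using 2 step[of u] that by simp
    next
      case 3
      then have "f' u = f u" "f' v = f v" using that by (simp_all add: f'_def)
      then show ?thesis using 3 by (simp add: crossing_def)
    qed
  qed
  have "even (\<Sum>v\<in>{0..<x}. \<Sum>u\<in>{0..<v}. crossing x n f' u v - crossing x n f u v
      - (of_bool (u = j0 \<and> v \<in> W) + of_bool (v = j0 \<and> u \<in> W)))"
    by (intro dvd_sum pair) auto
  also have "(\<Sum>v\<in>{0..<x}. \<Sum>u\<in>{0..<v}. crossing x n f' u v - crossing x n f u v
      - (of_bool (u = j0 \<and> v \<in> W) + of_bool (v = j0 \<and> u \<in> W)))
     = crossings x n f' - crossings x n f - int (card W)"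
  proof -
    have "W \<subseteq> {0..<x} - {j0}" by (auto simp: W_def)
    from sum_pairs_through_point[OF j0 this] show ?thesis
      unfolding crossings_def sum_subtractf by simp
  qed
  finally have "even (crossings x n f' - crossings x n f - int (card {t \<in> S. i < t \<and> t < i + k}))"
    unfolding cardW .
  then show ?thesis
    using that[of f'] qf' inj' ran' sum' by (auto simp: labelling_def f'_def)
qed

section \<open>Boundary loops as functions of the content\<close>

text \<open>
  A step to the right or down raises the content \<open>a - b\<close> of a vertex \<open>(a, b)\<close> by one. Thus an unrolled
  loop has exactly one vertex of each content, and it is determined by the first
  coordinates of these vertices. The definite description is meaningful for boundary loops.
\<close>

definition abscissa :: "(int \<times> int) set set \<Rightarrow> int \<Rightarrow> int" where
  "abscissa B t = (THE a. (a, a - t) \<in> \<Union>B)"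

definition profile :: "nat \<Rightarrow> nat \<Rightarrow> (int \<Rightarrow> int) \<Rightarrow> bool" where
  "profile x y a \<longleftrightarrow> (\<forall>t. a (t + 1) = a t \<or> a (t + 1) = a t + 1) \<and>
     quasi_periodic (int (x + y)) (int x) a"

text \<open>
  The contents at which the loop steps down, that is, the places of the letter \<open>1\<close>.
\<close>

definition beads :: "(int \<times> int) set set \<Rightarrow> int set" where
  "beads B = {t. abscissa B (t + 1) = abscissa B t}"

lemma mem_cyl_class:
  "(a, b) \<in> cyl_class x y (u, v) \<longleftrightarrow> (\<exists>m. a = u + m * int x \<and> b = v - m * int y)"
  by (auto simp: cyl_class_def cyl_rel_def)

lemma cyl_class_eq_iff:
  "cyl_class x y (a, b) = cyl_class x y (u, v) \<longleftrightarrow> (\<exists>m. a = u + m * int x \<and> b = v - m * int y)"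
proof
  assume "cyl_class x y (a, b) = cyl_class x y (u, v)"
  moreover have "(a, b) \<in> cyl_class x y (a, b)" unfolding mem_cyl_class by (intro exI[of _ 0]) simp
  ultimately show "\<exists>m. a = u + m * int x \<and> b = v - m * int y" unfolding mem_cyl_class[symmetric] by simp
next
  assume "\<exists>m. a = u + m * int x \<and> b = v - m * int y"
  then obtain m where m: "a = u + m * int x" "b = v - m * int y" by blast
  have "(c, d) \<in> cyl_class x y (a, b) \<longleftrightarrow> (c, d) \<in> cyl_class x y (u, v)" for c d
  proof
    assume "(c, d) \<in> cyl_class x y (a, b)"
    then obtain l where "c = a + l * int x" "d = b - l * int y" unfolding mem_cyl_class by blast
    then show "(c, d) \<in> cyl_class x y (u, v)"
      unfolding mem_cyl_class using m by (intro exI[of _ "m + l"]) (simp add: algebra_simps)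
  next
    assume "(c, d) \<in> cyl_class x y (u, v)"
    then obtain l where "c = u + l * int x" "d = v - l * int y" unfolding mem_cyl_class by blast
    then show "(c, d) \<in> cyl_class x y (a, b)"
      unfolding mem_cyl_class using m by (intro exI[of _ "l - m"]) (simp add: algebra_simps)
  qed
  then show "cyl_class x y (a, b) = cyl_class x y (u, v)" by (auto simp: set_eq_iff)
qed

lemma periodic_path_quasi_periodic:
  assumes "periodic_path x y p"
  shows "quasi_periodic (int (x + y)) (int x) (\<lambda>t. fst (p t))"
    and "quasi_periodic (int (x + y)) (- int y) (\<lambda>t. snd (p t))"
  using assms by (auto simp: periodic_path_def quasi_periodic_def)

lemma Union_loop_of_path:
  assumes "periodic_path x y p"
  shows "\<Union>(loop_of_path x y p) = range p"
proof (intro set_eqI iffI)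
  fix q assume "q \<in> \<Union>(loop_of_path x y p)"
  then obtain t where t: "q \<in> cyl_class x y (p t)" by (auto simp: loop_of_path_def)
  obtain a b where q: "q = (a, b)" by (cases q)
  obtain u v where p: "p t = (u, v)" by (cases "p t")
  obtain m where "a = u + m * int x" "b = v - m * int y" using t unfolding q p mem_cyl_class by blast
  then have "q = p (t + m * int (x + y))"
    using quasi_periodic_mult[OF periodic_path_quasi_periodic(1)[OF assms], of t m]
      quasi_periodic_mult[OF periodic_path_quasi_periodic(2)[OF assms], of t m] p q
    by (simp add: prod_eq_iff)
  then show "q \<in> range p" by blast
next
  fix q assume "q \<in> range p"
  then obtain t where "q = p t" by auto
  moreover have "p t \<in> cyl_class x y (p t)"
    by (cases "p t") (auto simp: mem_cyl_class intro: exI[of _ 0])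
  ultimately show "q \<in> \<Union>(loop_of_path x y p)" by (auto simp: loop_of_path_def)
qed

lemma path_content:
  assumes "periodic_path x y p"
  shows "fst (p t) - snd (p t) = t + (fst (p 0) - snd (p 0))"
proof -
  have "fst (p (j + 1)) - snd (p (j + 1)) - (j + 1) = fst (p j) - snd (p j) - j" for j
  proof -
    have "p (j + 1) = p j + (1, 0) \<or> p (j + 1) = p j + (0, -1)"
      using assms by (simp add: periodic_path_def)
    then show ?thesis by auto
  qed
  from const_of_step[of "\<lambda>j. fst (p j) - snd (p j) - j", OF this, of t] show ?thesis by simp
qed

lemma abscissa_loop_of_path:
  assumes p: "periodic_path x y p" and e: "e = fst (p 0) - snd (p 0)"
  shows "abscissa (loop_of_path x y p) (t + e) = fst (p t)"
  unfolding abscissa_def Union_loop_of_path[OF p]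
proof (rule the_equality)
  have "snd (p t) = fst (p t) - (t + e)" using path_content[OF p, of t] e by simp
  then show "(fst (p t), fst (p t) - (t + e)) \<in> range p" by (metis prod.collapse rangeI)
next
  fix a assume "(a, a - (t + e)) \<in> range p"
  then obtain s where s: "p s = (a, a - (t + e))" by (metis rangeE)
  then have "s = t" using path_content[OF p, of s] e by simp
  then show "a = fst (p t)" using s by simp
qed

lemma boundary_loop_abscissa:
  assumes "boundary_loop x y B"
  shows "profile x y (abscissa B)" and "(a, b) \<in> \<Union>B \<longleftrightarrow> a = abscissa B (a - b)"
proof -
  obtain p where p: "periodic_path x y p" and B: "B = loop_of_path x y p"
    using assms by (auto simp: boundary_loop_def)
  define e where "e = fst (p 0) - snd (p 0)"
  have "abscissa B (t + e) = fst (p t)" for t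
    unfolding B using abscissa_loop_of_path[OF p e_def] .
  from this[of "_ - e"] have ab: "abscissa B t = fst (p (t - e))" for t by simp
  have "abscissa B (t + 1) = abscissa B t \<or> abscissa B (t + 1) = abscissa B t + 1" for t
  proof -
    have "p ((t - e) + 1) = p (t - e) + (1, 0) \<or> p ((t - e) + 1) = p (t - e) + (0, -1)"
      using p unfolding periodic_path_def by blast
    moreover have "t + 1 - e = (t - e) + 1" by simp
    ultimately show ?thesis unfolding ab by (metis fst_add fst_conv add_0_right)
  qed
  moreover have "quasi_periodic (int (x + y)) (int x) (abscissa B)"
  proof -
    have "fst (p (t - e + int (x + y))) = fst (p (t - e)) + int x" for t
      using periodic_path_quasi_periodic(1)[OF p] unfolding quasi_periodic_def by blast
    moreover have "t + int (x + y) - e = t - e + int (x + y)" for t by simp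
    ultimately show ?thesis unfolding quasi_periodic_def ab by metis
  qed
  ultimately show "profile x y (abscissa B)" by (simp add: profile_def)
  show "(a, b) \<in> \<Union>B \<longleftrightarrow> a = abscissa B (a - b)"
  proof
    assume "(a, b) \<in> \<Union>B"
    then obtain t where t: "p t = (a, b)" unfolding B Union_loop_of_path[OF p] by (metis rangeE)
    then have "a - b - e = t" using path_content[OF p, of t] e_def by simp
    then show "a = abscissa B (a - b)" using t by (simp add: ab)
  next
    assume a: "a = abscissa B (a - b)"
    have "fst (p (a - b - e)) - snd (p (a - b - e)) = a - b" using path_content[OF p, of "a - b - e"] e_def by simp
    then have "p (a - b - e) = (a, b)" using a ab[of "a - b"] by (simp add: prod_eq_iff)
    then show "(a, b) \<in> \<Union>B" unfolding B Union_loop_of_path[OF p] by (metis rangeI)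
  qed
qed

lemma profile_mono:
  assumes "profile x y a" and "s \<le> t"
  shows "a s \<le> a t" and "a t - t \<le> a s - s"
proof -
  have "a s \<le> a t \<and> a t - t \<le> a s - s" using assms(2)
  proof (induction t rule: int_ge_induct)
    case (step i)
    have "a (i + 1) = a i \<or> a (i + 1) = a i + 1" using assms(1) by (simp add: profile_def)
    then show ?case using step by auto
  qed simp
  then show "a s \<le> a t" and "a t - t \<le> a s - s" by auto
qed

text \<open>
  To decide whether a point lies above and to the right of the loop, it suffices to compare it with the
  vertex on its own diagonal.
\<close>

lemma profile_dominated:
  assumes "profile x y a" and "a t \<le> c" and "a t - t \<le> d"
  shows "a (c - d) \<le> c"
proof (cases "t \<le> c - d")
  case True
  then show ?thesis using profile_mono(2)[OF assms(1) True] assms by linarith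
next
  case False
  then show ?thesis using profile_mono(1)[OF assms(1), of "c - d" t] assms by linarith
qed

lemma profile_shift:
  assumes "profile x y a"
  shows "a (t + m * int (x + y)) = a t + m * int x"
  using assms quasi_periodic_mult by (auto simp: profile_def)

lemma upper_right_boxes_iff:
  assumes "boundary_loop x y B"
  shows "cyl_class x y (a, b) \<in> upper_right_boxes x y B \<longleftrightarrow> abscissa B (a - b) \<le> a"
proof
  note prof = boundary_loop_abscissa[OF assms]
  assume "cyl_class x y (a, b) \<in> upper_right_boxes x y B"
  then obtain a' b' where eq: "cyl_class x y (a, b) = cyl_class x y (a', b')"
    and dom: "\<exists>(c, d) \<in> \<Union>B. c \<le> a' \<and> d \<le> b'"
    unfolding upper_right_boxes_def by blast
  obtain c d where cd: "(c, d) \<in> \<Union>B" "c \<le> a'" "d \<le> b'" using dom by blast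
  have "c = abscissa B (c - d)" using cd(1) prof(2) by blast
  then have "abscissa B (a' - b') \<le> a'"
    using cd by (intro profile_dominated[OF prof(1), of "c - d"]) auto
  moreover obtain m where m: "a = a' + m * int x" "b = b' - m * int y" using eq unfolding cyl_class_eq_iff by blast
  moreover have e: "a - b = (a' - b') + m * int (x + y)" using m by (simp add: algebra_simps)
  moreover have "abscissa B (a - b) = abscissa B (a' - b') + m * int x"
    unfolding e by (rule profile_shift[OF prof(1)])
  ultimately show "abscissa B (a - b) \<le> a" by linarith
next
  note prof = boundary_loop_abscissa[OF assms]
  assume le: "abscissa B (a - b) \<le> a"
  define c where "c = abscissa B (a - b)"
  have "(c, c - (a - b)) \<in> \<Union>B" unfolding prof(2) by (simp add: c_def)
  moreover have "c \<le> a" "c - (a - b) \<le> b" using le by (simp_all add: c_def)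
  ultimately have "\<exists>(c, d) \<in> \<Union>B. c \<le> a \<and> d \<le> b" by blast
  then show "cyl_class x y (a, b) \<in> upper_right_boxes x y B"
    unfolding upper_right_boxes_def by blast
qed

lemma boxes_iff:
  assumes "boundary_loop x y B" "boundary_loop x y B'"
  shows "cyl_class x y (a, b) \<in> boxes x y (B, B')
    \<longleftrightarrow> abscissa B (a - b) \<le> a \<and> a < abscissa B' (a - b)"
  using upper_right_boxes_iff[OF assms(1), of a b] upper_right_boxes_iff[OF assms(2), of a b]
  by (simp add: boxes_def not_le)

lemma boxesE:
  assumes "c \<in> boxes x y D"
  obtains a b where "c = cyl_class x y (a, b)"
  using assms unfolding boxes_def upper_right_boxes_def by blast

lemma cylindric_diagram_abscissa_le:
  assumes "cylindric_diagram x y (B, B')"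
  shows "abscissa B t \<le> abscissa B' t"
proof -
  have B: "boundary_loop x y B" "boundary_loop x y B'" and le: "weakly_left_below B B'"
    using assms by (auto simp: cylindric_diagram_def)
  define c where "c = abscissa B' t"
  have "(c, c - t) \<in> \<Union>B'" using boundary_loop_abscissa(2)[OF B(2)] by (simp add: c_def)
  then obtain a b where ab: "(a, b) \<in> \<Union>B" "a \<le> c" "b \<le> c - t"
    using le unfolding weakly_left_below_def by blast
  have "a = abscissa B (a - b)" using ab(1) boundary_loop_abscissa(2)[OF B(1)] by blast
  then have "abscissa B (c - (c - t)) \<le> c"
    using ab by (intro profile_dominated[OF boundary_loop_abscissa(1)[OF B(1)], of "a - b"]) auto
  then show ?thesis by (simp add: c_def)
qed

section \<open>Ribbons move one bead\<close>

definition ribbon_contents :: "diagram \<Rightarrow> int set" where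
  "ribbon_contents D = {t. abscissa (snd D) t = abscissa (fst D) t + 1}"

definition inner_box :: "nat \<Rightarrow> nat \<Rightarrow> diagram \<Rightarrow> int \<Rightarrow> (int \<times> int) set" where
  "inner_box x y D t = cyl_class x y (abscissa (fst D) t, abscissa (fst D) t - t)"

lemma card_periodic_window:
  fixes n :: int
  assumes "n > 0" and per: "\<And>t m. P (t + m * n) \<longleftrightarrow> P t"
  shows "card {t \<in> {a..<a + n}. P t} = card {t \<in> {0..<n}. P t}"
proof (rule bij_betw_same_card[where f = "\<lambda>t. t mod n"], rule bij_betw_imageI)
  have mod: "P (t mod n) \<longleftrightarrow> P t" for t
    using per[of "t mod n" "t div n"] by simp
  show "inj_on (\<lambda>t. t mod n) {t \<in> {a..<a + n}. P t}"
  proof (rule inj_onI)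
    fix s t assume st: "s \<in> {t \<in> {a..<a + n}. P t}" "t \<in> {t \<in> {a..<a + n}. P t}" "s mod n = t mod n"
    then have "n dvd s - t" "n dvd t - s" by (simp_all flip: mod_eq_dvd_iff)
    then show "s = t" using zdvd_imp_le[of n "s - t"] zdvd_imp_le[of n "t - s"] st by fastforce
  qed
  show "(\<lambda>t. t mod n) ` {t \<in> {a..<a + n}. P t} = {t \<in> {0..<n}. P t}"
  proof (intro set_eqI iffI)
    fix t assume t: "t \<in> {t \<in> {0..<n}. P t}"
    define s where "s = a + (t - a) mod n"
    have "s = t + (- ((t - a) div n)) * n"
      unfolding s_def by (simp add: minus_div_mult_eq_mod[symmetric])
    then have "P s" and "s mod n = t" using per[of t] t by (simp_all only: mod_mult_self1) auto
    moreover have "s \<in> {a..<a + n}" using assms(1) by (simp add: s_def)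
    ultimately have "s \<in> {t \<in> {a..<a + n}. P t}" by blast
    then show "t \<in> (\<lambda>t. t mod n) ` {t \<in> {a..<a + n}. P t}" using \<open>s mod n = t\<close> by blast
  next
    fix t assume "t \<in> (\<lambda>t. t mod n) ` {t \<in> {a..<a + n}. P t}"
    then show "t \<in> {t \<in> {0..<n}. P t}" using assms(1) mod by (clarsimp simp del: atLeastLessThan_iff) simp
  qed
qed

text \<open>
  Two boxes on the same diagonal of the difference of two loops span a block, since the loops
  change by at most one from one diagonal to the next. Hence a ribbon has at most one box per content.
\<close>

lemma ribbon_thin:
  assumes "ribbon x y k D" and "x \<ge> 1"
  shows "boundary_loop x y (fst D)" "boundary_loop x y (snd D)"
    "abscissa (fst D) t \<le> abscissa (snd D) t" "abscissa (snd D) t \<le> abscissa (fst D) t + 1"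
proof -
  obtain B B' where D: "D = (B, B')" by (cases D)
  have cyl: "cylindric_diagram x y (B, B')" and block: "\<not> has_block x y (boxes x y (B, B'))"
    using assms unfolding D ribbon_def by auto
  have B: "boundary_loop x y B" "boundary_loop x y B'" using cyl by (auto simp: cylindric_diagram_def)
  then show "boundary_loop x y (fst D)" "boundary_loop x y (snd D)" by (simp_all add: D)
  show "abscissa (fst D) t \<le> abscissa (snd D) t"
    using cylindric_diagram_abscissa_le[OF cyl] by (simp add: D)
  have step: "abscissa L (s + 1) = abscissa L s \<or> abscissa L (s + 1) = abscissa L s + 1"
    if "boundary_loop x y L" for L s
    using boundary_loop_abscissa(1)[OF that] by (simp add: profile_def)
  show "abscissa (snd D) t \<le> abscissa (fst D) t + 1"
  proof (rule ccontr)
    assume "\<not> ?thesis"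
    then have thick: "abscissa B' t \<ge> abscissa B t + 2" by (simp add: D)
    define a where "a = abscissa B t"
    define b where "b = a - t"
    have s1: "abscissa B (t + 1) \<le> a + 1" "abscissa B' (t + 1) \<ge> a + 2"
      using step[OF B(1), of t] step[OF B(2), of t] thick by (auto simp: a_def)
    have s2: "abscissa B (t - 1) \<le> a" "abscissa B' (t - 1) \<ge> a + 1"
      using step[OF B(1), of "t - 1"] step[OF B(2), of "t - 1"] thick by (auto simp: a_def)
    have "has_block x y (boxes x y (B, B'))"
      unfolding has_block_def
    proof (intro exI conjI)
      have e: "a - b = t" "a + 1 - b = t + 1" "a - (b + 1) = t - 1" "a + 1 - (b + 1) = t"
        by (simp_all add: b_def)
      show "cyl_class x y (a, b) \<in> boxes x y (B, B')"
        "cyl_class x y (a + 1, b) \<in> boxes x y (B, B')"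
        "cyl_class x y (a, b + 1) \<in> boxes x y (B, B')"
        "cyl_class x y (a + 1, b + 1) \<in> boxes x y (B, B')"
        unfolding boxes_iff[OF B] e using s1 s2 thick by (auto simp: a_def)
    qed
    then show False using block by simp
  qed
qed

text \<open>
  In the following, \<open>\<alpha>\<close> and \<open>\<beta>\<close> describe the two boundaries of one ribbon and \<open>R\<close> is the set of contents
  of its boxes in the plane; it is invariant under translation by the period \<open>n\<close>.
\<close>

context
  fixes x y k :: nat and D :: diagram and n :: int and \<alpha> \<beta> :: "int \<Rightarrow> int" and R :: "int set"
  assumes rib: "ribbon x y k D" and x1: "x \<ge> 1"
  defines "n \<equiv> int (x + y)" and "\<alpha> \<equiv> abscissa (fst D)" and "\<beta> \<equiv> abscissa (snd D)"
    and "R \<equiv> ribbon_contents D"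
begin

lemma period_pos: "n > 0" using x1 by (simp add: n_def)

lemma ribbon_profiles: "profile x y \<alpha>" "profile x y \<beta>"
  using ribbon_thin[OF rib x1] boundary_loop_abscissa(1) by (auto simp: \<alpha>_def \<beta>_def)

lemma ribbon_outer_abscissa: "\<beta> t = \<alpha> t + of_bool (t \<in> R)"
  using ribbon_thin(3,4)[OF rib x1, of t] by (auto simp: \<alpha>_def \<beta>_def R_def ribbon_contents_def)

lemma ribbon_contents_shift: "t + m * n \<in> R \<longleftrightarrow> t \<in> R"
proof -
  have "\<alpha> (t + m * n) = \<alpha> t + m * int x" "\<beta> (t + m * n) = \<beta> t + m * int x"
    unfolding n_def by (rule profile_shift[OF ribbon_profiles(1)], rule profile_shift[OF ribbon_profiles(2)])
  then show ?thesis by (simp add: R_def ribbon_contents_def \<alpha>_def \<beta>_def)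
qed

lemma inner_box_eq_iff: "inner_box x y D s = inner_box x y D t \<longleftrightarrow> n dvd s - t"
proof
  assume "inner_box x y D s = inner_box x y D t"
  then obtain m where "\<alpha> s = \<alpha> t + m * int x" "\<alpha> s - s = \<alpha> t - t - m * int y"
    unfolding inner_box_def cyl_class_eq_iff \<alpha>_def by blast
  then have "s - t = m * n" by (simp add: n_def algebra_simps)
  then show "n dvd s - t" by simp
next
  assume "n dvd s - t"
  then obtain m where "s - t = n * m" by auto
  then have s: "s = t + m * n" by (simp add: algebra_simps)
  then have "\<alpha> s = \<alpha> t + m * int x" using profile_shift[OF ribbon_profiles(1)] by (simp add: n_def)
  then show "inner_box x y D s = inner_box x y D t"
    unfolding inner_box_def cyl_class_eq_iff s
    by (intro exI[of _ m]) (simp add: \<alpha>_def[symmetric] n_def algebra_simps)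
qed

lemma ribbon_mem_boxes_iff: "cyl_class x y (a, b) \<in> boxes x y D \<longleftrightarrow> a - b \<in> R \<and> a = \<alpha> (a - b)"
proof -
  have "cyl_class x y (a, b) \<in> boxes x y D \<longleftrightarrow> \<alpha> (a - b) \<le> a \<and> a < \<beta> (a - b)"
    using boxes_iff[OF ribbon_thin(1,2)[OF rib x1]] by (simp add: \<alpha>_def \<beta>_def)
  then show ?thesis using ribbon_outer_abscissa[of "a - b"] by auto
qed

lemma ribbon_boxes_eq: "boxes x y D = inner_box x y D ` R"
proof (intro set_eqI iffI)
  fix c assume c: "c \<in> boxes x y D"
  then obtain a b where ab: "c = cyl_class x y (a, b)" by (rule boxesE)
  then have "a - b \<in> R" "a = \<alpha> (a - b)" using c ribbon_mem_boxes_iff by auto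
  moreover from this have "c = inner_box x y D (a - b)" unfolding ab inner_box_def \<alpha>_def by simp
  ultimately show "c \<in> inner_box x y D ` R" by blast
next
  fix c assume "c \<in> inner_box x y D ` R"
  then obtain t where "t \<in> R" "c = inner_box x y D t" by blast
  then show "c \<in> boxes x y D" using ribbon_mem_boxes_iff[of "\<alpha> t" "\<alpha> t - t"] by (simp add: inner_box_def \<alpha>_def)
qed

lemma inj_on_inner_box: "inj_on (inner_box x y D) {a..<a + n}"
proof (rule inj_onI)
  fix s t assume st: "s \<in> {a..<a + n}" "t \<in> {a..<a + n}" "inner_box x y D s = inner_box x y D t"
  then have "n dvd s - t" "n dvd t - s" using inner_box_eq_iff[of s t] inner_box_eq_iff[of t s] by simp_all
  then show "s = t" using zdvd_imp_le[of n "s - t"] zdvd_imp_le[of n "t - s"] st by fastforce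
qed

lemma ribbon_boxes_eq_window: "boxes x y D = inner_box x y D ` {t \<in> {0..<n}. t \<in> R}"
proof -
  have "inner_box x y D t \<in> inner_box x y D ` {t \<in> {0..<n}. t \<in> R}" if "t \<in> R" for t
  proof -
    have "t mod n \<in> R" using ribbon_contents_shift[of "t mod n" "t div n"] that by simp
    moreover have "inner_box x y D t = inner_box x y D (t mod n)"
      unfolding inner_box_eq_iff by (simp add: mod_eq_dvd_iff[symmetric])
    ultimately show ?thesis using period_pos by force
  qed
  then show ?thesis unfolding ribbon_boxes_eq by blast
qed

lemma card_ribbon_contents: "card {t \<in> {0..<n}. t \<in> R} = k"
proof -
  have "card (boxes x y D) = k" using rib by (simp add: ribbon_def)
  moreover have "inj_on (inner_box x y D) {t \<in> {0..<n}. t \<in> R}"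
    using inj_on_inner_box[of 0] by (auto intro: inj_on_subset)
  ultimately show ?thesis unfolding ribbon_boxes_eq_window by (simp add: card_image)
qed

lemma ribbon_sum_abscissa: "(\<Sum>t\<in>{0..<n}. \<beta> t) = (\<Sum>t\<in>{0..<n}. \<alpha> t) + int k"
proof -
  have "{0..<n} \<inter> R = {t \<in> {0..<n}. t \<in> R}" by auto
  then have "(\<Sum>t\<in>{0..<n}. of_bool (t \<in> R)) = int k"
    using card_ribbon_contents by (simp add: of_bool_def sum.If_cases)
  then show ?thesis by (simp add: ribbon_outer_abscissa sum.distrib)
qed

text \<open>
  Moving up lowers the content by one. The box of content \<open>t + 1\<close> has the box of content \<open>t\<close> above it
  exactly if the inner boundary steps down in between, and a vertical pair on the cylinder is
  determined by its upper box.
\<close>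

lemma ribbon_height_eq:
  "height x y D = card {t \<in> {0..<n}. t \<in> R \<and> t + 1 \<in> R \<and> \<alpha> (t + 1) = \<alpha> t}"
proof -
  let ?P = "\<lambda>t. t \<in> R \<and> t + 1 \<in> R \<and> \<alpha> (t + 1) = \<alpha> t"
  let ?f = "\<lambda>t. (inner_box x y D (t + 1), inner_box x y D t)"
  have pairs: "{(c, d). c \<in> boxes x y D \<and> d \<in> boxes x y D \<and> above d c} = ?f ` {t \<in> {0..<n}. ?P t}"
  proof (intro set_eqI iffI)
    fix q assume "q \<in> {(c, d). c \<in> boxes x y D \<and> d \<in> boxes x y D \<and> above d c}"
    then obtain c d where q: "q = (c, d)" and cd: "c \<in> boxes x y D" "d \<in> boxes x y D" "above d c" by blast
    obtain a b where ab: "(a, b) \<in> c" "(a, b + 1) \<in> d" using cd(3) unfolding above_def by blast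
    have cls: "e = cyl_class x y (a, b)" if "e \<in> boxes x y D" "(a, b) \<in> e" for e a b
    proof -
      obtain a' b' where "e = cyl_class x y (a', b')" using \<open>e \<in> boxes x y D\<close> by (rule boxesE)
      then show ?thesis using that(2) mem_cyl_class cyl_class_eq_iff by blast
    qed
    have c: "c = cyl_class x y (a, b)" and d: "d = cyl_class x y (a, b + 1)"
      using cls cd ab by auto
    define t where "t = a - (b + 1)"
    have tR: "t \<in> R" "a = \<alpha> t" "t + 1 \<in> R" "a = \<alpha> (t + 1)"
      using cd ribbon_mem_boxes_iff[of a b] ribbon_mem_boxes_iff[of a "b + 1"] unfolding c d
      by (simp_all add: t_def)
    have "c = inner_box x y D (t + 1)"
      unfolding c inner_box_def tR(4)[unfolded \<alpha>_def, symmetric] by (simp add: t_def)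
    moreover have "d = inner_box x y D t"
      unfolding d inner_box_def tR(2)[unfolded \<alpha>_def, symmetric] by (simp add: t_def)
    moreover have "t mod n \<in> {0..<n}" using period_pos by simp
    moreover have "n dvd t - t mod n" by (simp add: mod_eq_dvd_iff[symmetric])
    moreover from this have "inner_box x y D (t + 1) = inner_box x y D (t mod n + 1)"
      "inner_box x y D t = inner_box x y D (t mod n)" unfolding inner_box_eq_iff by simp_all
    moreover have "?P (t mod n)"
    proof -
      have t: "t = t mod n + (t div n) * n" "t + 1 = (t mod n + 1) + (t div n) * n" by simp_all
      have "\<alpha> (t mod n + (t div n) * n) = \<alpha> (t mod n) + t div n * int x"
        "\<alpha> ((t mod n + 1) + (t div n) * n) = \<alpha> (t mod n + 1) + t div n * int x"
        using profile_shift[OF ribbon_profiles(1)] by (simp_all only: n_def)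
      then have "\<alpha> t = \<alpha> (t mod n) + t div n * int x"
        "\<alpha> (t + 1) = \<alpha> (t mod n + 1) + t div n * int x" using t by metis+
      moreover have "t mod n \<in> R" "t mod n + 1 \<in> R" using tR(1,3) ribbon_contents_shift t by metis+
      ultimately show ?thesis using tR by simp
    qed
    ultimately show "q \<in> ?f ` {t \<in> {0..<n}. ?P t}" unfolding q by force
  next
    fix q assume "q \<in> ?f ` {t \<in> {0..<n}. ?P t}"
    then obtain t where t: "?P t" and q: "q = ?f t" by blast
    have "(\<alpha> t, \<alpha> t - (t + 1)) \<in> inner_box x y D (t + 1)"
      using t unfolding inner_box_def \<alpha>_def mem_cyl_class by (intro exI[of _ 0]) simp
    moreover have "(\<alpha> t, \<alpha> t - (t + 1) + 1) \<in> inner_box x y D t"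
      unfolding inner_box_def \<alpha>_def mem_cyl_class by (intro exI[of _ 0]) simp
    ultimately have "above (inner_box x y D t) (inner_box x y D (t + 1))" unfolding above_def by blast
    then show "q \<in> {(c, d). c \<in> boxes x y D \<and> d \<in> boxes x y D \<and> above d c}"
      using t unfolding q ribbon_boxes_eq by blast
  qed
  have "inj_on ?f {t \<in> {0..<n}. ?P t}"
    using inj_on_inner_box[of 0] by (auto simp: inj_on_def)
  then show ?thesis unfolding height_def pairs by (rule card_image)
qed

text \<open>
  All contents occur, so the height is the number of downward steps in a period.
\<close>

lemma loop_ribbon_height:
  assumes "k = x + y"
  shows "height x y D = y"
proof -
  have "{t \<in> {0..<n}. t \<in> R} = {0..<n}"
  proof (rule card_subset_eq)
    show "card {t \<in> {0..<n}. t \<in> R} = card {0..<n}" unfolding card_ribbon_contents using assms by (simp add: n_def)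
  qed auto
  then have "{0..<n} \<subseteq> R" by blast
  moreover have "t mod n \<in> {0..<n}" for t using period_pos by simp
  ultimately have "t \<in> R" for t using ribbon_contents_shift[of "t mod n" "t div n"] by auto
  then have h: "height x y D = card {t \<in> {0..<n}. \<alpha> (t + 1) = \<alpha> t}" unfolding ribbon_height_eq by simp
  have "\<alpha> (t + 1) - \<alpha> t = 1 - of_bool (\<alpha> (t + 1) = \<alpha> t)" for t
    using ribbon_profiles(1) by (auto simp: profile_def)
  then have "(\<Sum>t\<in>{0..<n}. \<alpha> (t + 1) - \<alpha> t) = (\<Sum>t\<in>{0..<n}. 1 - of_bool (\<alpha> (t + 1) = \<alpha> t))" by simp
  also have "\<dots> = n - int (card {t \<in> {0..<n}. \<alpha> (t + 1) = \<alpha> t})"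
  proof -
    have "{0..<n} \<inter> {t. \<alpha> (t + 1) = \<alpha> t} = {t \<in> {0..<n}. \<alpha> (t + 1) = \<alpha> t}" by auto
    then show ?thesis using period_pos by (simp add: sum_subtractf of_bool_def sum.If_cases)
  qed
  also have "(\<Sum>t\<in>{0..<n}. \<alpha> (t + 1) - \<alpha> t) = \<alpha> n - \<alpha> 0" using sum_telescope_int period_pos by simp
  also have "\<alpha> n = \<alpha> 0 + int x" using profile_shift[OF ribbon_profiles(1), of 0 1] by (simp add: n_def)
  finally show ?thesis unfolding h n_def by simp
qed

lemma edge_adjacent_contents:
  assumes "edge_adjacent (inner_box x y D s) (inner_box x y D t)"
  shows "n dvd t - (s + 1) \<or> n dvd t - (s - 1)"
proof -
  have mem: "n dvd (a - b) - u" if "(a, b) \<in> inner_box x y D u" for a b u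
  proof -
    obtain m where "a = \<alpha> u + m * int x" "b = \<alpha> u - u - m * int y"
      using \<open>(a, b) \<in> inner_box x y D u\<close> unfolding inner_box_def mem_cyl_class \<alpha>_def by blast
    then have "(a - b) - u = n * m" by (simp add: n_def algebra_simps)
    then show ?thesis by simp
  qed
  have two: "n dvd t' - (s' + 1)" if "n dvd c - s'" "n dvd c' - t'" "c' = c + 1" for c c' s' t'
  proof -
    have "n dvd (c - s') - (c' - t')" by (rule dvd_diff[OF that(1,2)])
    then show ?thesis using that(3) by (simp add: algebra_simps)
  qed
  have right: "n dvd t' - (s' + 1)" if r: "right_of (inner_box x y D t') (inner_box x y D s')" for s' t'
  proof -
    obtain a b where "(a, b) \<in> inner_box x y D s'" "(a + 1, b) \<in> inner_box x y D t'"
      using r unfolding right_of_def by blast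
    from two[OF mem[OF this(1)] mem[OF this(2)]] show ?thesis by simp
  qed
  have up: "n dvd s' - (t' + 1)" if ab: "above (inner_box x y D t') (inner_box x y D s')" for s' t'
  proof -
    obtain a b where "(a, b) \<in> inner_box x y D s'" "(a, b + 1) \<in> inner_box x y D t'"
      using ab unfolding above_def by blast
    from two[OF mem[OF this(2)] mem[OF this(1)]] show ?thesis by simp
  qed
  have flip: "n dvd t - (s - 1)" if "n dvd s - (t + 1)"
  proof -
    have "t - (s - 1) = - (s - (t + 1))" by simp
    then show ?thesis using that by (simp only: dvd_minus_iff)
  qed
  show ?thesis using assms right up flip unfolding edge_adjacent_def by blast
qed

text \<open>
  Adjacent boxes have consecutive contents. So a maximal run of consecutive contents in \<open>R\<close> is closed
  under adjacency, and by connectedness it exhausts the ribbon up to translation. A run has a gap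
  before it because the ribbon has fewer than \<open>n\<close> boxes.
\<close>

lemma ribbon_arc:
  assumes "1 \<le> k" "k < x + y"
  obtains i where "\<And>t. t \<in> R \<longleftrightarrow> (t - (i + 1)) mod n < int k"
proof -
  obtain u0 where u0: "u0 \<in> R" using card_ribbon_contents assms(1)
    by (metis (no_types, lifting) card.empty empty_Collect_eq not_one_le_zero)
  obtain w where w: "w \<notin> R"
  proof (rule ccontr)
    assume "\<not> thesis"
    then have "{t \<in> {0..<n}. t \<in> R} = {0..<n}" using that by auto
    then show False using card_ribbon_contents assms(2) period_pos by (simp add: n_def)
  qed
  \<comment> \<open>Translate the gap \<open>w\<close> to the left of \<open>u0\<close>; the last gap \<open>i\<close> before \<open>u0\<close> and the first gap \<open>l\<close>
      after \<open>i\<close> then enclose a run.\<close>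
  define q where "q = \<bar>w - u0\<bar> + 1"
  define w' where "w' = w + (- q) * n"
  have w'R: "w' \<notin> R" using w ribbon_contents_shift unfolding w'_def by blast
  have "q * 1 \<le> q * n" using period_pos by (intro mult_left_mono) (auto simp: q_def)
  moreover have "w' = w - q * n" by (simp add: w'_def)
  moreover have "w - q < u0" by (simp add: q_def)
  ultimately have "w' < u0" by linarith
  define G where "G = {t \<in> {w'..<u0}. t \<notin> R}"
  have "finite G" by (rule finite_subset[of _ "{w'..<u0}"]) (auto simp: G_def)
  moreover have "w' \<in> G" using w'R \<open>w' < u0\<close> by (simp add: G_def)
  ultimately have G: "finite G" "w' \<in> G" by auto
  define i where "i = Max G"
  have iG: "i \<in> G" using G Max_in unfolding i_def by blast
  have i1: "i + 1 \<in> R"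
  proof (rule ccontr)
    assume no: "i + 1 \<notin> R"
    then have "i + 1 \<noteq> u0" using u0 by blast
    then have "i + 1 \<in> G" using iG no by (auto simp: G_def)
    then show False using Max_ge[OF G(1), of "i + 1"] by (simp add: i_def)
  qed
  have iR: "i \<notin> R" using iG by (simp add: G_def)
  define H where "H = {t \<in> {i + 1..i + n}. t \<notin> R}"
  have "i + n \<notin> R" using ribbon_contents_shift[of i 1] iR by simp
  then have "i + n \<in> H" using period_pos by (simp add: H_def)
  moreover have "finite H" by (rule finite_subset[of _ "{i + 1..i + n}"]) (auto simp: H_def)
  ultimately have H: "finite H" "i + n \<in> H" by auto
  define l where "l = Min H"
  have lH: "l \<in> H" using H Min_in unfolding l_def by blast
  have l_le: "l \<le> i + n" "i + 1 < l" "l \<notin> R"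
    using lH i1 by (auto simp: H_def intro: le_neq_trans)
  define C where "C = {i + 1..<l}"
  have CR: "C \<subseteq> R"
  proof
    fix t assume t: "t \<in> C"
    show "t \<in> R"
    proof (rule ccontr)
      assume "t \<notin> R"
      then have "t \<in> H" using t l_le by (auto simp: C_def H_def)
      then show False using Min_le[OF H(1), of t] t by (simp add: C_def l_def)
    qed
  qed
  let ?box = "inner_box x y D"
  have closed: "d \<in> ?box ` C" if c: "c \<in> ?box ` C" and d: "d \<in> boxes x y D" and cd: "edge_adjacent c d" for c d
  proof -
    obtain s where s: "s \<in> C" "c = ?box s" using c by blast
    obtain t where t: "t \<in> R" "d = ?box t" using d ribbon_boxes_eq by blast
    have "n dvd t - (s + 1) \<or> n dvd t - (s - 1)"
      using edge_adjacent_contents cd unfolding s t by blast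
    then obtain s' where s': "n dvd t - s'" "s' = s + 1 \<or> s' = s - 1" by blast
    then obtain m where "t - s' = n * m" by auto
    then have "t = s' + m * n" by (simp add: algebra_simps)
    then have "s' \<in> R" using t ribbon_contents_shift by simp
    then have "s' \<noteq> i" "s' \<noteq> l" using iR l_le by auto
    then have "s' \<in> C" using s' s by (auto simp: C_def)
    moreover have "d = ?box s'" using s' t inner_box_eq_iff by simp
    ultimately show ?thesis by blast
  qed
  have all: "boxes x y D = ?box ` C"
  proof
    show "?box ` C \<subseteq> boxes x y D" unfolding ribbon_boxes_eq using CR by blast
    show "boxes x y D \<subseteq> ?box ` C"
    proof
      fix d assume d: "d \<in> boxes x y D"
      have start: "?box (i + 1) \<in> boxes x y D" "?box (i + 1) \<in> ?box ` C"
        using i1 l_le by (auto simp: ribbon_boxes_eq C_def)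
      have "(?box (i + 1), d) \<in> {(u, v). u \<in> boxes x y D \<and> v \<in> boxes x y D \<and> edge_adjacent u v}\<^sup>*"
        using rib start d unfolding ribbon_def edge_connected_def by blast
      then show "d \<in> ?box ` C"
        by (induction rule: rtrancl_induct) (use start closed in auto)
    qed
  qed
  have "inj_on ?box C"
    by (rule inj_on_subset[OF inj_on_inner_box[of "i + 1"]]) (use l_le in \<open>auto simp: C_def\<close>)
  then have "card (boxes x y D) = card C" unfolding all by (rule card_image)
  then have "k = nat (l - (i + 1))" using rib by (simp add: ribbon_def C_def)
  then have l: "l = i + 1 + int k" using l_le by simp
  have "t \<in> R \<longleftrightarrow> (t - (i + 1)) mod n < int k" for t
  proof
    assume "t \<in> R"
    then have "?box t \<in> ?box ` C" using all ribbon_boxes_eq by blast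
    then obtain s where s: "s \<in> C" "n dvd t - s" using inner_box_eq_iff by auto
    have "n dvd (t - (i + 1)) - (s - (i + 1))" using s by simp
    then have "(t - (i + 1)) mod n = (s - (i + 1)) mod n" by (simp only: mod_eq_dvd_iff)
    also have "\<dots> = s - (i + 1)" using s l_le by (auto simp: C_def)
    finally show "(t - (i + 1)) mod n < int k" using s l by (simp add: C_def)
  next
    assume lt: "(t - (i + 1)) mod n < int k"
    define s where "s = i + 1 + (t - (i + 1)) mod n"
    have "s \<in> C" using lt period_pos by (simp add: s_def C_def l)
    moreover have "t = s + ((t - (i + 1)) div n) * n" by (simp add: s_def algebra_simps)
    ultimately show "t \<in> R" using ribbon_contents_shift CR by (metis subsetD)
  qed
  then show ?thesis using that by blast
qed

text \<open>
  Raising the loop by one on the contents \<open>i + 1, \<dots>, i + k\<close> alters its steps only at the two ends: the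
  downward step at \<open>i\<close> becomes a step to the right, and the step to the right at \<open>i + k\<close> becomes a
  downward one. The beads strictly in between are the vertical adjacencies of the ribbon.
\<close>

lemma ribbon_bead_move:
  assumes k: "1 \<le> k" "k < x + y"
  obtains i where "i \<in> beads (fst D)" "i + int k \<notin> beads (fst D)"
    "beads (snd D) = (beads (fst D) - {t. n dvd t - i}) \<union> {t. n dvd t - (i + int k)}"
    "height x y D = card {t \<in> beads (fst D). i < t \<and> t < i + int k}"
proof -
  obtain i where arc: "\<And>t. t \<in> R \<longleftrightarrow> (t - (i + 1)) mod n < int k"
    using ribbon_arc[OF k] by blast
  have kn: "0 < int k" "int k < n" using k by (auto simp: n_def)
  have bead_in: "t \<in> beads (fst D) \<longleftrightarrow> \<alpha> (t + 1) = \<alpha> t" for t by (simp add: beads_def \<alpha>_def)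
  have bead_out: "t \<in> beads (snd D) \<longleftrightarrow> \<beta> (t + 1) = \<beta> t" for t by (simp add: beads_def \<beta>_def)
  have step: "\<alpha> (t + 1) = \<alpha> t \<or> \<alpha> (t + 1) = \<alpha> t + 1" "\<beta> (t + 1) = \<beta> t \<or> \<beta> (t + 1) = \<beta> t + 1" for t
    using ribbon_profiles by (auto simp: profile_def)
  have left: "t \<notin> R" "t + 1 \<in> R" if "n dvd t - i" for t
  proof -
    have "(t - i) mod n = 0" using that by simp
    then show "t + 1 \<in> R" unfolding arc using kn by (simp add: algebra_simps)
    have "(t - (i + 1)) mod n = (n - 1) mod n"
    proof -
      have "n dvd (t - i) - n" using that by (rule dvd_diff) simp
      then have "n dvd (t - (i + 1)) - (n - 1)" by (simp add: algebra_simps)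
      then show ?thesis by (simp only: mod_eq_dvd_iff)
    qed
    also have "\<dots> = n - 1" using period_pos by (intro mod_pos_pos_trivial) auto
    finally show "t \<notin> R" unfolding arc using kn by simp
  qed
  have right: "t \<in> R" "t + 1 \<notin> R" if "n dvd t - (i + int k)" for t
  proof -
    have "n dvd (t - (i + 1)) - (int k - 1)" "n dvd (t + 1 - (i + 1)) - int k"
      using that by (simp_all add: algebra_simps)
    then have "(t - (i + 1)) mod n = (int k - 1) mod n" "(t + 1 - (i + 1)) mod n = int k mod n"
      by (simp_all only: mod_eq_dvd_iff)
    then show "t \<in> R" "t + 1 \<notin> R" unfolding arc using kn by simp_all
  qed
  have same: "t \<in> R \<longleftrightarrow> t + 1 \<in> R" if "\<not> n dvd t - i" "\<not> n dvd t - (i + int k)" for t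
  proof -
    define r where "r = (t - (i + 1)) mod n"
    have r: "0 \<le> r" "r < n" using period_pos by (auto simp: r_def)
    have "n dvd (t - (i + 1)) - r" by (simp add: r_def mod_eq_dvd_iff[symmetric])
    then have d: "n dvd (t - i) - (r + 1)" by (simp add: algebra_simps)
    have "r + 1 \<noteq> n"
    proof
      assume "r + 1 = n"
      then have "n dvd ((t - i) - (r + 1)) + n" using d by (intro dvd_add) auto
      then show False using that(1) \<open>r + 1 = n\<close> by simp
    qed
    then have "(r + 1) mod n = r + 1" using r by simp
    moreover have "(t - i) mod n = (r + 1) mod n" using d by (simp only: mod_eq_dvd_iff)
    ultimately have "(t + 1 - (i + 1)) mod n = r + 1" by simp
    moreover have "r + 1 \<noteq> int k"
    proof
      assume "r + 1 = int k"
      then have "n dvd (t - i) - int k" using d by simp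
      then show False using that(2) by (simp add: algebra_simps)
    qed
    ultimately show ?thesis unfolding arc r_def[symmetric] by auto
  qed
  have 1: "i \<in> beads (fst D)"
    using left[of i] step[of i] ribbon_outer_abscissa[of i] ribbon_outer_abscissa[of "i + 1"] unfolding bead_in by auto
  have 2: "i + int k \<notin> beads (fst D)"
    using right[of "i + int k"] step[of "i + int k"] ribbon_outer_abscissa[of "i + int k"] ribbon_outer_abscissa[of "i + int k + 1"]
    unfolding bead_in by auto
  have 3: "beads (snd D) = (beads (fst D) - {t. n dvd t - i}) \<union> {t. n dvd t - (i + int k)}"
  proof (rule set_eqI)
    fix t
    consider "n dvd t - i" | "n dvd t - (i + int k)" | "\<not> n dvd t - i" "\<not> n dvd t - (i + int k)" by blast
    then show "t \<in> beads (snd D) \<longleftrightarrow> t \<in> (beads (fst D) - {t. n dvd t - i}) \<union> {t. n dvd t - (i + int k)}"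
    proof cases
      case 1
      then have "\<not> n dvd t - (i + int k)" using left right by blast
      moreover have "t \<notin> beads (snd D)"
        using left[OF 1] step[of t] ribbon_outer_abscissa[of t] ribbon_outer_abscissa[of "t + 1"] unfolding bead_out by auto
      ultimately show ?thesis using 1 by simp
    next
      case 2
      moreover have "t \<in> beads (snd D)"
        using right[OF 2] step[of t] ribbon_outer_abscissa[of t] ribbon_outer_abscissa[of "t + 1"] unfolding bead_out by auto
      ultimately show ?thesis by simp
    next
      case 3
      then show ?thesis
        using same[OF 3] ribbon_outer_abscissa[of t] ribbon_outer_abscissa[of "t + 1"] bead_in bead_out by simp
    qed
  qed
  have 4: "height x y D = card {t \<in> beads (fst D). i < t \<and> t < i + int k}"
  proof -
    let ?P = "\<lambda>t. t \<in> R \<and> t + 1 \<in> R \<and> \<alpha> (t + 1) = \<alpha> t"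
    have "?P (t + m * n) \<longleftrightarrow> ?P t" for t m
    proof -
      have "t + 1 + m * n \<in> R \<longleftrightarrow> t + 1 \<in> R" by (rule ribbon_contents_shift)
      moreover have "\<alpha> (t + 1 + m * n) = \<alpha> (t + 1) + m * int x" "\<alpha> (t + m * n) = \<alpha> t + m * int x"
        using profile_shift[OF ribbon_profiles(1)] by (simp_all only: n_def)
      moreover have "t + m * n + 1 = t + 1 + m * n" by simp
      moreover have "t + m * n \<in> R \<longleftrightarrow> t \<in> R" by (rule ribbon_contents_shift)
      ultimately show ?thesis by (simp only:) simp
    qed
    then have "height x y D = card {t \<in> {i..<i + n}. ?P t}"
      unfolding ribbon_height_eq by (intro card_periodic_window[OF period_pos, symmetric])
    also have "{t \<in> {i..<i + n}. ?P t} = {t \<in> beads (fst D). i < t \<and> t < i + int k}"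
    proof (intro set_eqI iffI)
      fix t assume "t \<in> {t \<in> {i..<i + n}. ?P t}"
      then have t: "i \<le> t" "t < i + n" "?P t" by auto
      have "t \<noteq> i" using left(1)[of i] t by auto
      then have "(t - (i + 1)) mod n = t - (i + 1)" using t by simp
      then have "t \<le> i + int k" using t arc[of t] by simp
      moreover have "t \<noteq> i + int k" using right(2)[of t] t by auto
      ultimately show "t \<in> {t \<in> beads (fst D). i < t \<and> t < i + int k}"
        using t \<open>t \<noteq> i\<close> bead_in by simp
    next
      fix t assume "t \<in> {t \<in> beads (fst D). i < t \<and> t < i + int k}"
      then have t: "\<alpha> (t + 1) = \<alpha> t" "i < t" "t < i + int k" using bead_in by auto
      then have "(t - (i + 1)) mod n = t - (i + 1)" "(t + 1 - (i + 1)) mod n = t + 1 - (i + 1)"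
        using kn by simp_all
      then have "t \<in> R" "t + 1 \<in> R" unfolding arc using t by simp_all
      then show "t \<in> {t \<in> {i..<i + n}. ?P t}" using t kn by simp
    qed
    finally show ?thesis .
  qed
  show ?thesis by (rule that[OF 1 2 3 4])
qed

end

section \<open>Tilings as bead games\<close>

lemma length_concat_replicate_pair: "length (concat (replicate m [a, b])) = 2 * m"
  by (induction m) auto

lemma nth_concat_replicate_pair:
  "i < 2 * m \<Longrightarrow> concat (replicate m [a, b]) ! i = (if even i then a else b)"
proof (induction m arbitrary: i)
  case (Suc m)
  consider "i = 0" | "i = 1" | j where "i = j + 2" by (metis One_nat_def add_2_eq_Suc' not0_implies_Suc)
  then show ?case using Suc by cases auto
qed simp

text \<open>
  The beads of a staircase are the integers of one parity. This uniform spacing is what makes all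
  runners look alike.
\<close>

lemma inner_strict_labelling:
  assumes "inner_strict x y D" and "x \<ge> 1"
  obtains e where "labelling (int x) (int (x + y)) (beads (fst D)) (\<lambda>j. 2 * j + e)"
proof -
  obtain p where p: "periodic_path x y p" and B: "fst D = loop_of_path x y p"
    and w: "concat (replicate x [1, 0]) = map (\<lambda>i. path_letter p (int i)) [0..<x + y]"
    using assms(1) unfolding inner_strict_def loop_has_word_def by blast
  have xy: "x = y"
    using arg_cong[OF w, of length] by (simp add: length_concat_replicate_pair)
  define n where "n = int (x + y)"
  define e where "e = fst (p 0) - snd (p 0)"
  have n: "n > 0" "even n" using assms(2) xy by (auto simp: n_def)
  have letter: "path_letter p (int i) = (if even i then 1 else 0)" if "i < x + y" for i
  proof -
    have "path_letter p (int i) = concat (replicate x [1, 0]) ! i"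
      unfolding w using that by simp
    also have "\<dots> = (if even i then 1 else 0)"
      using that xy by (intro nth_concat_replicate_pair) simp
    finally show ?thesis .
  qed
  have flat: "fst (p (t + 1)) = fst (p t) \<longleftrightarrow> even t" for t
  proof -
    define s where "s = t mod n"
    have s: "0 \<le> s" "s < n" using n by (auto simp: s_def)
    have t: "t = s + (t div n) * int (x + y)"
      unfolding s_def n_def by (rule mod_div_mult_eq[symmetric])
    have "fst (p (s + (t div n) * int (x + y))) = fst (p s) + t div n * int x"
      "fst (p (s + 1 + (t div n) * int (x + y))) = fst (p (s + 1)) + t div n * int x"
      using quasi_periodic_mult[OF periodic_path_quasi_periodic(1)[OF p]] by blast+
    moreover have "t + 1 = s + 1 + (t div n) * int (x + y)" using t by simp
    ultimately have "fst (p (t + 1)) = fst (p t) \<longleftrightarrow> fst (p (s + 1)) = fst (p s)"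
      using t by (metis add_right_cancel)
    also have "\<dots> \<longleftrightarrow> path_letter p (int (nat s)) = 1"
    proof -
      have "p (s + 1) = p s + (1, 0) \<or> p (s + 1) = p s + (0, -1)"
        using p by (simp add: periodic_path_def)
      then show ?thesis using s(1) by (auto simp: path_letter_def)
    qed
    also have "\<dots> \<longleftrightarrow> even (nat s)"
      using letter[of "nat s"] s by (simp add: n_def nat_less_iff)
    also have "\<dots> \<longleftrightarrow> even s" using s(1) by (simp add: even_nat_iff)
    also have "\<dots> \<longleftrightarrow> even t" using n(2) by (simp add: s_def dvd_mod_iff)
    finally show ?thesis .
  qed
  have "t \<in> beads (fst D) \<longleftrightarrow> even (t - e)" for t
  proof -
    have "abscissa (fst D) (t - e + e) = fst (p (t - e))"
      "abscissa (fst D) (t - e + 1 + e) = fst (p (t - e + 1))"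
      unfolding B by (rule abscissa_loop_of_path[OF p e_def])+
    moreover have "t - e + e = t" "t - e + 1 + e = t + 1" by simp_all
    ultimately show ?thesis using flat[of "t - e"] unfolding beads_def mem_Collect_eq by metis
  qed
  then have "beads (fst D) = {t. even (t - e)}" by blast
  also have "\<dots> = range (\<lambda>j. 2 * j + e)"
  proof (intro set_eqI iffI)
    fix t assume "t \<in> {t. even (t - e)}"
    then have "even (t - e)" by (rule CollectD)
    then obtain j where "t - e = 2 * j" by (rule evenE)
    then have "t = 2 * j + e" by simp
    then show "t \<in> range (\<lambda>j. 2 * j + e)" by blast
  qed auto
  finally have "beads (fst D) = range (\<lambda>j. 2 * j + e)" .
  then have "labelling (int x) (int (x + y)) (beads (fst D)) (\<lambda>j. 2 * j + e)"
    using xy by (simp add: labelling_def quasi_periodic_def inj_def)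
  then show ?thesis by (rule that)
qed

lemma tilingD:
  assumes "ribbon_tiling x y k D T"
  shows "T \<noteq> []" "snd (T ! 0) = fst D" "T ! (length T - 1) = D"
    "Suc i < length T \<Longrightarrow> ribbon x y k (diagram_quotient (T ! Suc i) (T ! i))"
proof -
  show ne: "T \<noteq> []" using assms by (simp add: ribbon_tiling_def)
  show "snd (T ! 0) = fst D" "T ! (length T - 1) = D"
    using assms hd_conv_nth[OF ne] last_conv_nth[OF ne] by (simp_all add: ribbon_tiling_def)
  show "ribbon x y k (diagram_quotient (T ! Suc i) (T ! i))" if "Suc i < length T"
    using assms that by (simp add: ribbon_tiling_def)
qed

text \<open>
  The sum of the first coordinates over a period measures the area below the loop, and each
  ribbon adds \<open>k\<close> to it; so the number of ribbons depends on the diagram only.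
\<close>

lemma tiling_sum_abscissa:
  assumes T: "ribbon_tiling x y k D T" and "x \<ge> 1" and "m < length T"
  shows "(\<Sum>t\<in>{0..<int (x + y)}. abscissa (snd (T ! m)) t)
       = (\<Sum>t\<in>{0..<int (x + y)}. abscissa (fst D) t) + int m * int k"
  using assms(3)
proof (induction m)
  case 0
  then show ?case using tilingD(2)[OF T] by simp
next
  case (Suc m)
  then show ?case
    using ribbon_sum_abscissa[OF tilingD(4)[OF T Suc.prems] assms(2)]
    by (simp add: diagram_quotient_def algebra_simps)
qed

lemma tiling_length_unique:
  assumes "ribbon_tiling x y k D T" "ribbon_tiling x y k D T'" "x \<ge> 1" "k \<ge> 1"
  shows "length T = length T'"
proof -
  have "(\<Sum>t\<in>{0..<int (x + y)}. abscissa (snd D) t)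
      = (\<Sum>t\<in>{0..<int (x + y)}. abscissa (fst D) t) + int (length U - 1) * int k"
    if U: "ribbon_tiling x y k D U" for U
    using tiling_sum_abscissa[OF U assms(3), of "length U - 1"] tilingD(1,3)[OF U] by simp
  from this[OF assms(1)] this[OF assms(2)] have "int (length T - 1) * int k = int (length T' - 1) * int k"
    by linarith
  then have "length T - 1 = length T' - 1" using assms(4) by simp
  moreover have "length T > 0" "length T' > 0" using tilingD(1) assms by auto
  ultimately show ?thesis by linarith
qed

text \<open>
  Along a tiling the labels travel with the beads. What is recorded besides the crossings is
  what pins down the labelling in the end: residues modulo \<open>k\<close>, the order of the beads in each
  residue class, and the sum of the positions.
\<close>

lemma tiling_labelling:
  assumes T: "ribbon_tiling x y k D T" and "x \<ge> 1" and k: "1 \<le> k" "k < x + y"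
    and f0: "labelling (int x) (int (x + y)) (beads (fst D)) f0" and "m < length T"
  shows "\<exists>f. labelling (int x) (int (x + y)) (beads (snd (T ! m))) f \<and>
    (\<forall>j. int k dvd f j - f0 j) \<and>
    (\<forall>u v. f0 u < f0 v \<and> int k dvd f0 v - f0 u \<longrightarrow> f u < f v) \<and>
    (\<Sum>j\<in>{0..<int x}. f j) = (\<Sum>j\<in>{0..<int x}. f0 j) + int m * int k \<and>
    even (crossings (int x) (int (x + y)) f - crossings (int x) (int (x + y)) f0
       - int (\<Sum>i<m. height x y (diagram_quotient (T ! Suc i) (T ! i))))"
  using \<open>m < length T\<close>
proof (induction m)
  case 0
  then show ?case using f0 tilingD(2)[OF T] by (intro exI[of _ f0]) simp
next
  case (Suc m)
  have "m < length T" using Suc.prems by simp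
  from Suc.IH[OF this] obtain f where f: "labelling (int x) (int (x + y)) (beads (snd (T ! m))) f"
    and f_cong: "\<And>j. int k dvd f j - f0 j"
    and f_mono: "\<And>u v. \<lbrakk>f0 u < f0 v; int k dvd f0 v - f0 u\<rbrakk> \<Longrightarrow> f u < f v"
    and f_sum: "(\<Sum>j\<in>{0..<int x}. f j) = (\<Sum>j\<in>{0..<int x}. f0 j) + int m * int k"
    and f_even: "even (crossings (int x) (int (x + y)) f - crossings (int x) (int (x + y)) f0
       - int (\<Sum>i<m. height x y (diagram_quotient (T ! Suc i) (T ! i))))"
    by (elim exE conjE) blast
  let ?Q = "diagram_quotient (T ! Suc m) (T ! m)"
  have rib: "ribbon x y k ?Q" using tilingD(4)[OF T Suc.prems] .
  have Q: "fst ?Q = snd (T ! m)" "snd ?Q = snd (T ! Suc m)" by (simp_all add: diagram_quotient_def)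
  obtain i where i: "i \<in> beads (snd (T ! m))" "i + int k \<notin> beads (snd (T ! m))"
    and S': "beads (snd (T ! Suc m)) = (beads (snd (T ! m)) - {t. int (x + y) dvd t - i})
        \<union> {t. int (x + y) dvd t - (i + int k)}"
    and h: "height x y ?Q = card {t \<in> beads (snd (T ! m)). i < t \<and> t < i + int k}"
    by (rule ribbon_bead_move[OF rib assms(2) k, unfolded Q])
  have pos: "0 < int x" "0 < int k" "int k < int (x + y)" using assms by auto
  obtain f' where f': "labelling (int x) (int (x + y)) (beads (snd (T ! Suc m))) f'"
    and f'_step: "\<And>j. f' j = f j \<or> f' j = f j + int k"
    and f'_sum: "(\<Sum>j\<in>{0..<int x}. f' j) = (\<Sum>j\<in>{0..<int x}. f j) + int k"
    and f'_even: "even (crossings (int x) (int (x + y)) f' - crossings (int x) (int (x + y)) f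
       - int (card {t \<in> beads (snd (T ! m)). i < t \<and> t < i + int k}))"
    by (rule bead_move[OF f pos i S']) (rule that; blast)
  have cong': "int k dvd f' j - f0 j" for j
  proof -
    have "f' j - f0 j = f j - f0 j \<or> f' j - f0 j = (f j - f0 j) + int k" using f'_step[of j] by auto
    moreover have "int k dvd (f j - f0 j) + int k" using f_cong[of j] by (rule dvd_add) simp
    ultimately show ?thesis using f_cong[of j] by metis
  qed
  have mono': "f' u < f' v" if uv: "f0 u < f0 v" "int k dvd f0 v - f0 u" for u v
  proof -
    have "int k dvd (f v - f0 v) - (f u - f0 u) + (f0 v - f0 u)"
      by (rule dvd_add[OF dvd_diff[OF f_cong f_cong] uv(2)])
    then have "int k dvd f v - f u" by simp
    moreover have "f u < f v" using f_mono uv by blast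
    ultimately have "f u + int k \<le> f v" using zdvd_imp_le[of "int k" "f v - f u"] by simp
    then have "f' u \<le> f' v" using f'_step[of u] f'_step[of v] pos by auto
    moreover have "f' u \<noteq> f' v"
      using f' uv unfolding labelling_def inj_def by blast
    ultimately show ?thesis by simp
  qed
  have "even (crossings (int x) (int (x + y)) f' - crossings (int x) (int (x + y)) f0
       - int (\<Sum>i<Suc m. height x y (diagram_quotient (T ! Suc i) (T ! i))))"
  proof -
    have "even ((crossings (int x) (int (x + y)) f' - crossings (int x) (int (x + y)) f
          - int (height x y ?Q))
        + (crossings (int x) (int (x + y)) f - crossings (int x) (int (x + y)) f0
          - int (\<Sum>i<m. height x y (diagram_quotient (T ! Suc i) (T ! i)))))"
      by (rule dvd_add[OF f'_even[folded h] f_even])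
    moreover have "\<And>a b c d e :: int. (a - b - d) + (b - c - e) = a - c - (e + d)" by simp
    ultimately show ?thesis by simp
  qed
  then show ?case
    using f' cong' mono' f_sum f'_sum by (intro exI[of _ f']) (auto simp: algebra_simps)
qed

lemma dvd_double_iff:
  fixes k d :: int
  shows "k dvd 2 * d \<longleftrightarrow> (if even k then k div 2 else k) dvd d"
proof (cases "even k")
  case True
  then obtain c where "k = 2 * c" by auto
  then show ?thesis by simp
next
  case False
  then have "coprime k 2" by (simp add: coprime_commute)
  then show ?thesis using False by (simp add: coprime_dvd_mult_right_iff)
qed

text \<open>
  Initially bead \<open>j\<close> stands at \<open>2 * j + e\<close>. Two beads are therefore congruent modulo \<open>k\<close> exactly if
  their labels are congruent modulo \<open>K\<close>, which is \<open>k\<close> or \<open>k div 2\<close> according to the parity of \<open>k\<close>.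
\<close>

lemma total_height_parity_of_short_ribbons:
  assumes T: "ribbon_tiling x y k D T" and T': "ribbon_tiling x y k D T'"
    and strict: "inner_strict x y D" and x: "x \<ge> 1" and k: "1 \<le> k" "k < x + y"
  shows "even (int (total_height x y T) - int (total_height x y T'))"
proof -
  define n where "n = int (x + y)"
  define K where "K = (if even (int k) then int k div 2 else int k)"
  have K: "int k dvd 2 * d \<longleftrightarrow> K dvd d" for d unfolding K_def by (rule dvd_double_iff)
  have "K > 0" using k by (auto simp: K_def elim!: evenE)
  have pos: "0 < int x" "0 < n" using x by (auto simp: n_def)
  obtain e where f0: "labelling (int x) n (beads (fst D)) (\<lambda>j. 2 * j + e)"
    using inner_strict_labelling[OF strict x] unfolding n_def by blast
  have final: "\<exists>f. labelling (int x) n (beads (snd D)) f \<and>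
      (\<forall>j. int k dvd f j - (2 * j + e)) \<and> (\<forall>u v. u < v \<and> K dvd v - u \<longrightarrow> f u < f v) \<and>
      (\<Sum>j\<in>{0..<int x}. f j) = (\<Sum>j\<in>{0..<int x}. 2 * j + e) + int (length U - 1) * int k \<and>
      even (crossings (int x) n f - crossings (int x) n (\<lambda>j. 2 * j + e) - int (total_height x y U))"
    if U: "ribbon_tiling x y k D U" for U
  proof -
    have "int k dvd 2 * v + e - (2 * u + e) \<longleftrightarrow> K dvd v - u" for u v
      using K[of "v - u"] by (simp add: algebra_simps)
    then show ?thesis
      using tiling_labelling[OF U x k f0[unfolded n_def], of "length U - 1"] tilingD(1,3)[OF U]
      unfolding total_height_def n_def by simp
  qed
  obtain f where f: "labelling (int x) n (beads (snd D)) f"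
    and f_cong: "\<And>j. int k dvd f j - (2 * j + e)"
    and f_mono: "\<And>u v. \<lbrakk>u < v; K dvd v - u\<rbrakk> \<Longrightarrow> f u < f v"
    and f_sum: "(\<Sum>j\<in>{0..<int x}. f j) = (\<Sum>j\<in>{0..<int x}. 2 * j + e) + int (length T - 1) * int k"
    and f_even: "even (crossings (int x) n f - crossings (int x) n (\<lambda>j. 2 * j + e)
      - int (total_height x y T))"
    using final[OF T] by blast
  obtain g where g: "labelling (int x) n (beads (snd D)) g"
    and g_cong: "\<And>j. int k dvd g j - (2 * j + e)"
    and g_mono: "\<And>u v. \<lbrakk>u < v; K dvd v - u\<rbrakk> \<Longrightarrow> g u < g v"
    and g_sum: "(\<Sum>j\<in>{0..<int x}. g j) = (\<Sum>j\<in>{0..<int x}. 2 * j + e) + int (length T' - 1) * int k"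
    and g_even: "even (crossings (int x) n g - crossings (int x) n (\<lambda>j. 2 * j + e)
      - int (total_height x y T'))"
    using final[OF T'] by blast
  have res: "K dvd u - v" if "f u = g v" for u v
  proof -
    have "int k dvd (g v - (2 * v + e)) - (f u - (2 * u + e))" by (rule dvd_diff[OF g_cong f_cong])
    also have "(g v - (2 * v + e)) - (f u - (2 * u + e)) = 2 * (u - v)" using that by simp
    finally show ?thesis by (simp only: K)
  qed
  have "even (crossings (int x) n f - crossings (int x) n g)"
    by (rule crossings_parity_unique[OF f g pos \<open>K > 0\<close> res f_mono g_mono])
       (use f_sum g_sum tiling_length_unique[OF T T' x k(1)] in auto)
  then show ?thesis using f_even g_even by simp
qed

theorem corollary24:
  fixes x y k :: nat and D :: diagram and T T' :: "diagram list"
  assumes "x \<ge> 1" and "y \<ge> 1" and "k \<ge> 1"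
    and "cylindric_diagram x y D"
    and "inner_strict x y D"
    and "ribbon_tiling x y k D T"
    and "ribbon_tiling x y k D T'"
  shows "total_height x y T mod 2 = total_height x y T' mod 2"
proof (cases "k < x + y")
  case True
  then have "even (int (total_height x y T) - int (total_height x y T'))"
    using total_height_parity_of_short_ribbons assms by blast
  then show ?thesis by presburger
next
  \<comment> \<open>Each ribbon is a loop of height \<open>y\<close>, and the number of ribbons is fixed.\<close>
  case False
  have "total_height x y U = (length U - 1) * y" if U: "ribbon_tiling x y k D U" for U
  proof -
    have "height x y (diagram_quotient (U ! Suc i) (U ! i)) = y" if "i < length U - 1" for i
    proof -
      have rib: "ribbon x y k (diagram_quotient (U ! Suc i) (U ! i))"
        using tilingD(4)[OF U] that by simp
      then have "k = x + y" using False by (simp add: ribbon_def)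
      then show ?thesis using loop_ribbon_height[OF rib assms(1)] by simp
    qed
    then show ?thesis unfolding total_height_def by simp
  qed
  then show ?thesis using tiling_length_unique[OF assms(6,7,1,3)] assms(6,7) by simp
qed

end
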